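(* Let $K$ be a field of characteristic $0$ and let $C_{32}$ be the algebra of invariants of two $3\times 3$ matrices under simultaneous conjugation by $GL_3(K)$. With the elements $v,w,w_1,w_2,w_3',w_3'',w_4,w_5,w_6,w_7$ defined in the context, the algebra $C_{32}$ has the following presentation. It is generated by the eleven elements $$\mathrm{tr}(X),\ \mathrm{tr}(Y),\ \mathrm{tr}(x^2),\ \mathrm{tr}(xy),\ \mathrm{tr}(y^2),\ \mathrm{tr}(x^3),\ \mathrm{tr}(x^2y),\ \mathrm{tr}(xy^2),\ \mathrm{tr}(y^3),\ v,\ w$$ subject to the defining relation $$w^2-\left(\frac{1}{27}w_1-\frac{2}{9}w_2+\frac{4}{15}w_3'+\frac{1}{90}w_3''+\frac{1}{3}w_4-\frac{2}{3}w_5-\frac{1}{3}w_6-\frac{4}{27}w_7\right)=0.$$ That is, these eleven elements generate $C_{32}$ as a $K$-algebra, and the kernel of the surjection onto $C_{32}$ from the polynomial algebra over $K$ in eleven variables corresponding to these generators is the principal ideal generated by the left-hand side of the relation, where $w_1,w_2,w_3',w_3'',w_4,w_5,w_6,w_7$ are read as the polynomials in the variables corresponding to $\mathrm{tr}(x^2),\mathrm{tr}(xy),\mathrm{tr}(y^2),\mathrm{tr}(x^3),\mathrm{tr}(x^2y),\mathrm{tr}(xy^2),\mathrm{tr}(y^3),v$ given by their defining formulas.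
   Context: Let $X=(x_{pq})$ and $Y=(y_{pq})$, $p,q=1,2,3$, be two generic $3\times 3$ matrices, whose $18$ entries are algebraically independent commuting variables over $K$, and let $\Omega$ be the polynomial algebra over $K$ in these $18$ variables. The group $GL_3(K)$ acts on $\Omega$ by algebra automorphisms: $g$ sends each entry of $X$ (resp. $Y$) to the corresponding entry of $gXg^{-1}$ (resp. $gYg^{-1}$). $C_{32}=\Omega^{GL_3(K)}$ is the algebra of invariants. Let $e$ be the identity matrix and $x=X-\frac13\mathrm{tr}(X)e$, $y=Y-\frac13\mathrm{tr}(Y)e$ (generic traceless matrices). Write $\mathrm{tr}^k(z)=(\mathrm{tr}(z))^k$. Define the following elements of $C_{32}$: $$v=\mathrm{tr}(x^2y^2)-\mathrm{tr}(xyxy),\qquad w=\mathrm{tr}(x^2y^2xy)-\mathrm{tr}(y^2x^2yx),$$ $$u=\begin{vmatrix}\mathrm{tr}(x^2)&\mathrm{tr}(xy)\\ \mathrm{tr}(xy)&\mathrm{tr}(y^2)\end{vmatrix},\qquad w_1=u^3,\quad w_2=u^2v,\quad w_4=uv^2,\quad w_7=v^3,$$ $$D=\begin{vmatrix}\mathrm{tr}(x^2)&\mathrm{tr}(xy)&\mathrm{tr}(y^2)\\ \mathrm{tr}(x^3)&\mathrm{tr}(x^2y)&\mathrm{tr}(xy^2)\\ \mathrm{tr}(x^2y)&\mathrm{tr}(xy^2)&\mathrm{tr}(y^3)\end{vmatrix},\qquad w_5=vD,\quad w_3'=uD,$$ $$w_6=\begin{vmatrix}\mathrm{tr}(x^3)&\mathrm{tr}(xy^2)\\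 \mathrm{tr}(x^2y)&\mathrm{tr}(y^3)\end{vmatrix}^2-4\begin{vmatrix}\mathrm{tr}(y^3)&\mathrm{tr}(xy^2)\\ \mathrm{tr}(xy^2)&\mathrm{tr}(x^2y)\end{vmatrix}\begin{vmatrix}\mathrm{tr}(x^3)&\mathrm{tr}(x^2y)\\ \mathrm{tr}(x^2y)&\mathrm{tr}(xy^2)\end{vmatrix},$$ $$\begin{aligned}w_3''={}&5[\mathrm{tr}^3(y^2)\mathrm{tr}^2(x^3)+\mathrm{tr}^3(x^2)\mathrm{tr}^2(y^3)]\\ &-30[\mathrm{tr}^2(y^2)\mathrm{tr}(xy)\mathrm{tr}(x^2y)\mathrm{tr}(x^3)+\mathrm{tr}^2(x^2)\mathrm{tr}(xy)\mathrm{tr}(y^3)\mathrm{tr}(xy^2)]\\ &+3\{[4\mathrm{tr}(y^2)\mathrm{tr}^2(xy)+\mathrm{tr}^2(y^2)\mathrm{tr}(x^2)][3\mathrm{tr}^2(x^2y)+2\mathrm{tr}(xy^2)\mathrm{tr}(x^3)]\\ &\quad+[4\mathrm{tr}^2(xy)\mathrm{tr}(x^2)+\mathrm{tr}^2(x^2)\mathrm{tr}(y^2)][3\mathrm{tr}^2(xy^2)+2\mathrm{tr}(x^2y)\mathrm{tr}(y^3)]\}\\ &-2[2\mathrm{tr}^3(xy)+3\mathrm{tr}(x^2)\mathrm{tr}(xy)\mathrm{tr}(y^2)][9\mathrm{tr}(xy^2)\mathrm{tr}(x^2y)+\mathrm{tr}(x^3)\mathrm{tr}(y^3)].\end{aligned}$$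 *)

theory Defs
  imports "HOL-Analysis.Determinants" "HOL-Library.Poly_Mapping"
begin

section \<open>Polynomial algebras over a field\<close>

text \<open>The polynomial algebra over \<open>'k\<close> in the commuting variables \<open>'x\<close>: a polynomial is a
  finitely supported family of coefficients indexed by monomials, a monomial is a finitely
  supported family of exponents.  The ring structure is that of \<^theory>\<open>HOL-Library.Poly_Mapping\<close>.\<close>

type_synonym ('x, 'k) mpoly = "('x \<Rightarrow>\<^sub>0 nat) \<Rightarrow>\<^sub>0 'k"

definition Const :: "'k \<Rightarrow> ('x, 'k::comm_ring_1) mpoly" where
  "Const c = Poly_Mapping.single 0 c"

definition Var :: "'x \<Rightarrow> ('x, 'k::comm_ring_1) mpoly" where
  "Var i = Poly_Mapping.single (Poly_Mapping.single i 1) 1"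

text \<open>The homomorphism of \<open>'k\<close>-algebras sending each variable \<open>i\<close> to \<open>f i\<close>.\<close>

definition alg_hom ::
  "('x \<Rightarrow> ('y, 'k) mpoly) \<Rightarrow> ('x, 'k::comm_ring_1) mpoly \<Rightarrow> ('y, 'k) mpoly" where
  "alg_hom f p =
     (\<Sum>m\<in>Poly_Mapping.keys p. Const (Poly_Mapping.lookup p m) *
        (\<Prod>i\<in>Poly_Mapping.keys m. f i ^ Poly_Mapping.lookup m i))"

definition is_subalgebra :: "('x, 'k::comm_ring_1) mpoly set \<Rightarrow> bool" where
  "is_subalgebra A \<longleftrightarrow>
     range Const \<subseteq> A \<and> (\<forall>p\<in>A. \<forall>q\<in>A. p + q \<in> A \<and> p * q \<in> A)"

definition generated_subalgebra :: "('x, 'k::comm_ring_1) mpoly set \<Rightarrow> ('x, 'k) mpoly set" where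
  "generated_subalgebra S = \<Inter> {A. is_subalgebra A \<and> S \<subseteq> A}"

definition principal_ideal :: "'a::comm_ring_1 \<Rightarrow> 'a set" where
  "principal_ideal r = {q * r | q. True}"

section \<open>Generic matrices and invariants\<close>

datatype entry = X_entry 3 3 | Y_entry 3 3

type_synonym 'k Omega = "(entry, 'k) mpoly"

definition X_mat :: "('k::field_char_0 Omega)^3^3" where
  "X_mat = (\<chi> p q. Var (X_entry p q))"

definition Y_mat :: "('k::field_char_0 Omega)^3^3" where
  "Y_mat = (\<chi> p q. Var (Y_entry p q))"

definition const_matrix :: "'k::field_char_0^3^3 \<Rightarrow> ('k Omega)^3^3" where
  "const_matrix g = (\<chi> p q. Const (g $ p $ q))"

definition conjugate :: "'k::field_char_0^3^3 \<Rightarrow> ('k Omega)^3^3 \<Rightarrow> ('k Omega)^3^3" where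
  "conjugate g Z = const_matrix g ** Z ** const_matrix (matrix_inv g)"

definition GL3_act :: "'k::field_char_0^3^3 \<Rightarrow> 'k Omega \<Rightarrow> 'k Omega" where
  "GL3_act g = alg_hom (\<lambda>e. case e of X_entry p q \<Rightarrow> conjugate g X_mat $ p $ q
                                    | Y_entry p q \<Rightarrow> conjugate g Y_mat $ p $ q)"

definition C32 :: "'k::field_char_0 Omega set" where
  "C32 = {f. \<forall>g::'k^3^3. invertible g \<longrightarrow> GL3_act g f = f}"

definition traceless_part :: "('k::field_char_0 Omega)^3^3 \<Rightarrow> ('k Omega)^3^3" where
  "traceless_part Z = Z - mat (Const (1/3) * trace Z)"

definition x_mat :: "('k::field_char_0 Omega)^3^3" where
  "x_mat = traceless_part X_mat"

definition y_mat :: "('k::field_char_0 Omega)^3^3" where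
  "y_mat = traceless_part Y_mat"

section \<open>The eleven generators and the defining relation\<close>

text \<open>One variable for each generator: \<open>G_xxy\<close> corresponds to \<open>tr(x\<^sup>2y)\<close>, and so on.\<close>

datatype gen = G_X | G_Y | G_xx | G_xy | G_yy | G_xxx | G_xxy | G_xyy | G_yyy | G_v | G_w

fun generator :: "gen \<Rightarrow> 'k::field_char_0 Omega" where
  "generator G_X = trace X_mat"
| "generator G_Y = trace Y_mat"
| "generator G_xx = trace (x_mat ** x_mat)"
| "generator G_xy = trace (x_mat ** y_mat)"
| "generator G_yy = trace (y_mat ** y_mat)"
| "generator G_xxx = trace (x_mat ** x_mat ** x_mat)"
| "generator G_xxy = trace (x_mat ** x_mat ** y_mat)"
| "generator G_xyy = trace (x_mat ** y_mat ** y_mat)"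
| "generator G_yyy = trace (y_mat ** y_mat ** y_mat)"
| "generator G_v = trace (x_mat ** x_mat ** y_mat ** y_mat)
     - trace (x_mat ** y_mat ** x_mat ** y_mat)"
| "generator G_w = trace (x_mat ** x_mat ** y_mat ** y_mat ** x_mat ** y_mat)
     - trace (y_mat ** y_mat ** x_mat ** x_mat ** y_mat ** x_mat)"

text \<open>The elements \<open>u\<close> (\<open>det_u\<close>), \<open>D\<close> (\<open>det_D\<close>), \<open>w\<^sub>1, \<dots>, w\<^sub>7\<close> as functions of
  the values \<open>t\<close> of the generators, in an arbitrary commutative ring: \<open>t = generator\<close> gives the elements of the algebra of invariants,
  \<open>t = Var\<close> the corresponding polynomials in the eleven variables.\<close>

definition det22 :: "'a::comm_ring_1 \<Rightarrow> 'a \<Rightarrow> 'a \<Rightarrow> 'a \<Rightarrow> 'a" where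
  "det22 a b c d = det (vector [vector [a, b], vector [c, d]] :: 'a^2^2)"

definition det_u :: "(gen \<Rightarrow> 'a::comm_ring_1) \<Rightarrow> 'a" where
  "det_u t = det22 (t G_xx) (t G_xy)
                   (t G_xy) (t G_yy)"

definition det_D :: "(gen \<Rightarrow> 'a::comm_ring_1) \<Rightarrow> 'a" where
  "det_D t = det (vector [vector [t G_xx,  t G_xy,  t G_yy],
                          vector [t G_xxx, t G_xxy, t G_xyy],
                          vector [t G_xxy, t G_xyy, t G_yyy]] :: 'a^3^3)"

definition w1 :: "(gen \<Rightarrow> 'a::comm_ring_1) \<Rightarrow> 'a" where
  "w1 t = det_u t ^ 3"

definition w2 :: "(gen \<Rightarrow> 'a::comm_ring_1) \<Rightarrow> 'a" where
  "w2 t = det_u t ^ 2 * t G_v"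

definition w3' :: "(gen \<Rightarrow> 'a::comm_ring_1) \<Rightarrow> 'a" where
  "w3' t = det_u t * det_D t"

definition w3'' :: "(gen \<Rightarrow> 'a::comm_ring_1) \<Rightarrow> 'a" where
  "w3'' t =
     5 * (t G_yy ^ 3 * t G_xxx ^ 2 + t G_xx ^ 3 * t G_yyy ^ 2)
   - 30 * (t G_yy ^ 2 * t G_xy * t G_xxy * t G_xxx + t G_xx ^ 2 * t G_xy * t G_yyy * t G_xyy)
   + 3 * ((4 * t G_yy * t G_xy ^ 2 + t G_yy ^ 2 * t G_xx) * (3 * t G_xxy ^ 2 + 2 * t G_xyy * t G_xxx)
        + (4 * t G_xy ^ 2 * t G_xx + t G_xx ^ 2 * t G_yy) * (3 * t G_xyy ^ 2 + 2 * t G_xxy * t G_yyy))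
   - 2 * (2 * t G_xy ^ 3 + 3 * t G_xx * t G_xy * t G_yy) * (9 * t G_xyy * t G_xxy + t G_xxx * t G_yyy)"

definition w4 :: "(gen \<Rightarrow> 'a::comm_ring_1) \<Rightarrow> 'a" where
  "w4 t = det_u t * t G_v ^ 2"

definition w5 :: "(gen \<Rightarrow> 'a::comm_ring_1) \<Rightarrow> 'a" where
  "w5 t = t G_v * det_D t"

definition w6 :: "(gen \<Rightarrow> 'a::comm_ring_1) \<Rightarrow> 'a" where
  "w6 t = (det22 (t G_xxx) (t G_xyy)
                 (t G_xxy) (t G_yyy)) ^ 2
        - 4 * det22 (t G_yyy) (t G_xyy)
                    (t G_xyy) (t G_xxy)
            * det22 (t G_xxx) (t G_xxy)
                    (t G_xxy) (t G_xyy)"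

definition w7 :: "(gen \<Rightarrow> 'a::comm_ring_1) \<Rightarrow> 'a" where
  "w7 t = t G_v ^ 3"

definition relation :: "(gen, 'k::field_char_0) mpoly" where
  "relation = Var G_w ^ 2 -
     (Const (1/27) * w1 Var - Const (2/9) * w2 Var + Const (4/15) * w3' Var
      + Const (1/90) * w3'' Var + Const (1/3) * w4 Var - Const (2/3) * w5 Var
      - Const (1/3) * w6 Var - Const (4/27) * w7 Var)"

end

theory Submission
  imports Defs "HOL-Computational_Algebra.Polynomial"
begin

text \<open>Let \<open>A\<close> be the algebra generated by the eleven traces; \<open>A \<subseteq> C32\<close> because traces are
invariant under conjugation.  The converse inclusion is proved here without the first fundamental
theorem of matrix invariants.  Call slice the set of pairs \<open>(X, Y)\<close> with \<open>X\<close> diagonal.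

An invariant vanishing on the slice is zero (\<open>invariant_vanishing_on_diagonal_slice\<close>), since a generic
\<open>X\<close> is conjugate to a companion matrix, a companion matrix whose characteristic polynomial has distinct
roots in the field is conjugate to a diagonal one, and such split polynomials are Zariski dense.  Hence
identities between invariants, the defining relation among them (\<open>relation_holds\<close>), need only be
checked on the slice.  There an invariant is fixed by the diagonal torus and by the permutation matrices.
Torus invariance makes it a polynomial in the eigenvalues of \<open>X\<close>, the diagonal entries of \<open>Y\<close>, the
products \<open>y\<^sub>i\<^sub>j y\<^sub>j\<^sub>i\<close> and the two 3-cycles \<open>y\<^sub>1\<^sub>2 y\<^sub>2\<^sub>3 y\<^sub>3\<^sub>1\<close> and \<open>y\<^sub>1\<^sub>3 y\<^sub>3\<^sub>2 y\<^sub>2\<^sub>1\<close>.  After inverting the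
discriminant of \<open>x\<close>, interpolation at the eigenvalues writes all of these as polynomials in the eigenvalues
with coefficients in \<open>A\<close> (\<open>torus_invariants_local\<close>).  Averaging over the permutations turns the powers of the
eigenvalues into power sums, which lie in \<open>A\<close>.  So some power of the discriminant of \<open>x\<close> multiplies a
given invariant into \<open>A\<close> (\<open>x_disc_power_in_trace_algebra\<close>), and by symmetry so does some power of the
discriminant of \<open>y\<close>.

The structure of \<open>A\<close> removes these denominators.  The first ten generators are algebraically independent:
the values that they take on the slice are Zariski dense (\<open>w_free_independent\<close>).  Simultaneous transposition fixes them and changes the sign of \<open>w\<close>, so that
\<open>A = K[ten] \<oplus> K[ten] w\<close> is free of rank two over the polynomial ring in ten variables; this already
determines the kernel (\<open>kernel_principal\<close>).  The discriminant of \<open>x\<close> involves only \<open>tr(x\<^sup>2)\<close> and \<open>tr(x\<^sup>3)\<close>, that of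
\<open>y\<close> only \<open>tr(y\<^sup>2)\<close> and \<open>tr(y\<^sup>3)\<close>, so their powers are coprime in this polynomial ring, and an element that
powers of both of them multiply into \<open>A\<close> lies in \<open>A\<close> itself (\<open>C32_subset_trace_algebra\<close>).\<close>

section \<open>Evaluation of polynomials\<close>

definition is_ring_hom :: "('a::comm_ring_1 \<Rightarrow> 'b::comm_ring_1) \<Rightarrow> bool" where
  "is_ring_hom h \<longleftrightarrow> h 1 = 1 \<and> (\<forall>a b. h (a + b) = h a + h b \<and> h (a * b) = h a * h b)"

lemma is_ring_homI:
  assumes "h 1 = 1" "\<And>a b. h (a + b) = h a + h b" "\<And>a b. h (a * b) = h a * h b"
  shows "is_ring_hom h"
  using assms by (simp add: is_ring_hom_def)

lemma is_ring_hom_comp: "is_ring_hom g \<Longrightarrow> is_ring_hom h \<Longrightarrow> is_ring_hom (\<lambda>a. h (g a))"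
  by (simp add: is_ring_hom_def)

context
  fixes h :: "'a::comm_ring_1 \<Rightarrow> 'b::comm_ring_1"
  assumes h: "is_ring_hom h"
begin

lemma ring_hom_1: "h 1 = 1" using h by (simp add: is_ring_hom_def)
lemma ring_hom_add: "h (a + b) = h a + h b" using h by (simp add: is_ring_hom_def)
lemma ring_hom_mult: "h (a * b) = h a * h b" using h by (simp add: is_ring_hom_def)
lemma ring_hom_0: "h 0 = 0" using ring_hom_add[of 0 0] by simp
lemma ring_hom_uminus: "h (- a) = - h a"
  using ring_hom_add[of a "- a"] by (simp add: ring_hom_0 eq_neg_iff_add_eq_0 add.commute)
lemma ring_hom_diff: "h (a - b) = h a - h b"
  using ring_hom_add[of a "- b"] by (simp add: ring_hom_uminus)
lemma ring_hom_power: "h (a ^ n) = h a ^ n"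
  by (induction n) (simp_all add: ring_hom_1 ring_hom_mult)
lemma ring_hom_of_nat: "h (of_nat n) = of_nat n"
  by (induction n) (simp_all add: ring_hom_0 ring_hom_1 ring_hom_add)
lemma ring_hom_numeral: "h (numeral k) = numeral k"
  using ring_hom_of_nat[of "numeral k"] by simp
lemma ring_hom_sum: "h (sum f A) = (\<Sum>a\<in>A. h (f a))"
  by (induction A rule: infinite_finite_induct) (simp_all add: ring_hom_0 ring_hom_add)
lemma ring_hom_prod: "h (prod f A) = (\<Prod>a\<in>A. h (f a))"
  by (induction A rule: infinite_finite_induct) (simp_all add: ring_hom_1 ring_hom_mult)

lemmas ring_hom_simps = ring_hom_0 ring_hom_1 ring_hom_add ring_hom_mult ring_hom_uminus
  ring_hom_diff ring_hom_power ring_hom_numeral ring_hom_sum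

end

definition monom_value :: "('x \<Rightarrow> 'a::comm_ring_1) \<Rightarrow> ('x \<Rightarrow>\<^sub>0 nat) \<Rightarrow> 'a" where
  "monom_value f m = (\<Prod>i\<in>Poly_Mapping.keys m. f i ^ Poly_Mapping.lookup m i)"

text \<open>The homomorphism out of a polynomial algebra given by a homomorphism on the coefficients and the values
of the variables.  Besides \<open>alg_hom\<close> it covers evaluation at a point and the passage to univariate polynomials.\<close>
definition eval_mpoly ::
  "('k::comm_ring_1 \<Rightarrow> 'a::comm_ring_1) \<Rightarrow> ('x \<Rightarrow> 'a) \<Rightarrow> ('x, 'k) mpoly \<Rightarrow> 'a" where
  "eval_mpoly \<phi> f p = (\<Sum>m\<in>Poly_Mapping.keys p. \<phi> (Poly_Mapping.lookup p m) * monom_value f m)"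

lemma alg_hom_eq_eval: "alg_hom f = eval_mpoly Const f"
  by (simp add: fun_eq_iff alg_hom_def eval_mpoly_def monom_value_def)

lemma monom_value_superset:
  assumes "finite S" "Poly_Mapping.keys m \<subseteq> S"
  shows "monom_value f m = (\<Prod>i\<in>S. f i ^ Poly_Mapping.lookup m i)"
  unfolding monom_value_def
  by (rule prod.mono_neutral_left) (use assms in \<open>auto simp: in_keys_iff\<close>)

lemma monom_value_0 [simp]: "monom_value f 0 = 1"
  by (simp add: monom_value_def)

lemma monom_value_add: "monom_value f (m + n) = monom_value f m * monom_value f n"
proof -
  let ?S = "Poly_Mapping.keys m \<union> Poly_Mapping.keys n"
  have "monom_value f (m + n) = (\<Prod>i\<in>?S. f i ^ Poly_Mapping.lookup (m + n) i)"
    by (rule monom_value_superset) (auto simp: keys_add)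
  also have "\<dots> = (\<Prod>i\<in>?S. f i ^ Poly_Mapping.lookup m i) * (\<Prod>i\<in>?S. f i ^ Poly_Mapping.lookup n i)"
    by (simp add: lookup_add power_add prod.distrib)
  also have "\<dots> = monom_value f m * monom_value f n"
    by (simp add: monom_value_superset[of ?S m] monom_value_superset[of ?S n])
  finally show ?thesis .
qed

lemma monom_value_single [simp]: "monom_value f (Poly_Mapping.single i k) = f i ^ k"
  by (cases "k = 0") (simp_all add: monom_value_def)

lemma eval_mpoly_superset:
  assumes "is_ring_hom \<phi>" "finite S" "Poly_Mapping.keys p \<subseteq> S"
  shows "eval_mpoly \<phi> f p = (\<Sum>m\<in>S. \<phi> (Poly_Mapping.lookup p m) * monom_value f m)"
  unfolding eval_mpoly_def
  by (rule sum.mono_neutral_left) (use assms in \<open>auto simp: in_keys_iff ring_hom_0\<close>)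

lemma eval_mpoly_add:
  assumes "is_ring_hom \<phi>"
  shows "eval_mpoly \<phi> f (p + q) = eval_mpoly \<phi> f p + eval_mpoly \<phi> f q"
proof -
  let ?S = "Poly_Mapping.keys p \<union> Poly_Mapping.keys q"
  have 1: "finite ?S" "Poly_Mapping.keys (p + q) \<subseteq> ?S" by (auto simp: keys_add)
  show ?thesis
    by (simp add: eval_mpoly_superset[OF assms 1] eval_mpoly_superset[OF assms 1(1), of p]
        eval_mpoly_superset[OF assms 1(1), of q] lookup_add ring_hom_add[OF assms]
        algebra_simps sum.distrib)
qed

lemma eval_mpoly_single:
  assumes "is_ring_hom \<phi>"
  shows "eval_mpoly \<phi> f (Poly_Mapping.single m c) = \<phi> c * monom_value f m"
  by (cases "c = 0") (simp_all add: eval_mpoly_def ring_hom_0[OF assms])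

lemma mpoly_sum_monomials:
  "p = (\<Sum>m\<in>Poly_Mapping.keys p. Poly_Mapping.single m (Poly_Mapping.lookup p m))"
proof (rule poly_mapping_eqI)
  fix k
  show "Poly_Mapping.lookup p k = Poly_Mapping.lookup
    (\<Sum>m\<in>Poly_Mapping.keys p. Poly_Mapping.single m (Poly_Mapping.lookup p m)) k"
    by (simp add: lookup_sum lookup_single when_def in_keys_iff)
qed

lemma eval_mpoly_sum:
  assumes "is_ring_hom \<phi>"
  shows "eval_mpoly \<phi> f (sum g A) = (\<Sum>a\<in>A. eval_mpoly \<phi> f (g a))"
  by (induction A rule: infinite_finite_induct)
    (simp_all add: eval_mpoly_add[OF assms] eval_mpoly_def[of _ _ 0])

lemma eval_mpoly_mult:
  assumes "is_ring_hom \<phi>"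
  shows "eval_mpoly \<phi> f (p * q) = eval_mpoly \<phi> f p * eval_mpoly \<phi> f q"
proof -
  let ?s = "\<lambda>p m. Poly_Mapping.single m (Poly_Mapping.lookup p m)"
  have "eval_mpoly \<phi> f (p * q)
      = eval_mpoly \<phi> f ((\<Sum>m\<in>Poly_Mapping.keys p. ?s p m) * (\<Sum>n\<in>Poly_Mapping.keys q. ?s q n))"
    using mpoly_sum_monomials[of p] mpoly_sum_monomials[of q] by simp
  also have "\<dots> = (\<Sum>m\<in>Poly_Mapping.keys p. \<Sum>n\<in>Poly_Mapping.keys q.
      (\<phi> (Poly_Mapping.lookup p m) * monom_value f m) * (\<phi> (Poly_Mapping.lookup q n) * monom_value f n))"
    by (simp add: sum_product eval_mpoly_sum[OF assms] mult_single eval_mpoly_single[OF assms]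
        ring_hom_mult[OF assms] monom_value_add mult_ac)
  also have "\<dots> = eval_mpoly \<phi> f p * eval_mpoly \<phi> f q"
    by (simp add: eval_mpoly_def sum_product)
  finally show ?thesis .
qed

lemma eval_mpoly_Const [simp]: "is_ring_hom \<phi> \<Longrightarrow> eval_mpoly \<phi> f (Const c) = \<phi> c"
  by (simp add: Const_def eval_mpoly_single)

lemma eval_mpoly_Var [simp]: "is_ring_hom \<phi> \<Longrightarrow> eval_mpoly \<phi> f (Var i) = f i"
  by (simp add: Var_def eval_mpoly_single ring_hom_1)

lemma Const_hom: "is_ring_hom Const"
  by (rule is_ring_homI) (simp_all add: Const_def single_add mult_single)

lemma id_hom: "is_ring_hom (\<lambda>x. x)"
  by (rule is_ring_homI) simp_all

lemma eval_mpoly_hom: "is_ring_hom \<phi> \<Longrightarrow> is_ring_hom (eval_mpoly \<phi> f)"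
  using eval_mpoly_single[of \<phi> f 0 1]
  by (intro is_ring_homI) (simp_all add: eval_mpoly_add eval_mpoly_mult ring_hom_1)

lemma alg_hom_hom: "is_ring_hom (alg_hom f)"
  by (simp add: alg_hom_eq_eval eval_mpoly_hom Const_hom)

lemma alg_hom_Const [simp]: "alg_hom f (Const c) = Const c"
  and alg_hom_Var [simp]: "alg_hom f (Var i) = f i"
  by (simp_all add: alg_hom_eq_eval Const_hom)

text \<open>Composing with a homomorphism moves it to the coefficients and to the values of the variables; this
reduces equalities between homomorphisms to the variables.\<close>
lemma hom_eval_mpoly:
  assumes "is_ring_hom h"
  shows "h (eval_mpoly \<phi> f p) = eval_mpoly (\<lambda>c. h (\<phi> c)) (\<lambda>i. h (f i)) p"
  by (simp add: eval_mpoly_def monom_value_def ring_hom_sum[OF assms] ring_hom_mult[OF assms]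
      ring_hom_prod[OF assms] ring_hom_power[OF assms])

lemma Const_mult_monomial:
  "Const c * monom_value Var m = Poly_Mapping.single m c"
proof -
  have *: "(\<Prod>i\<in>A. Poly_Mapping.single (Poly_Mapping.single i 1) (1::'b) ^ e i)
      = Poly_Mapping.single (\<Sum>i\<in>A. Poly_Mapping.single i (e i)) 1" if "finite A"
    for A :: "'a set" and e :: "'a \<Rightarrow> nat"
  proof -
    have 1: "Poly_Mapping.single (Poly_Mapping.single i 1) (1::'b) ^ n
      = Poly_Mapping.single (Poly_Mapping.single i n) 1" for i :: 'a and n
      by (induction n) (simp_all add: mult_single flip: single_add)
    show ?thesis using that
      by (induction A) (simp_all add: 1[unfolded One_nat_def] mult_single flip: single_one)
  qed
  show ?thesis
    by (simp add: monom_value_def Var_def * [unfolded One_nat_def] Const_def mult_single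
        flip: mpoly_sum_monomials)
qed

lemma alg_hom_Var_id: "alg_hom Var p = p"
  unfolding alg_hom_eq_eval eval_mpoly_def Const_mult_monomial
  by (rule mpoly_sum_monomials[symmetric])

lemma hom_eq_eval:
  assumes "is_ring_hom h"
  shows "h p = eval_mpoly (\<lambda>c. h (Const c)) (\<lambda>i. h (Var i)) p"
  using hom_eval_mpoly[OF assms, of Const Var p] alg_hom_Var_id[of p]
  by (simp add: alg_hom_eq_eval)

lemma mpoly_hom_eqI:
  assumes "is_ring_hom g" "is_ring_hom h" "\<And>c. g (Const c) = h (Const c)" "\<And>i. g (Var i) = h (Var i)"
  shows "g p = h p"
  using hom_eq_eval[OF assms(1), of p] hom_eq_eval[OF assms(2), of p] assms(3,4) by simp

lemma alg_hom_alg_hom: "alg_hom f (alg_hom g p) = alg_hom (\<lambda>i. alg_hom f (g i)) p"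
  using hom_eval_mpoly[OF alg_hom_hom[of f], of Const g p] by (simp add: alg_hom_eq_eval Const_hom)

lemma mpoly_induct [case_names Const Var add mult]:
  assumes "\<And>c. P (Const c)" "\<And>i. P (Var i)"
    and add: "\<And>p q. P p \<Longrightarrow> P q \<Longrightarrow> P (p + q)" and mult: "\<And>p q. P p \<Longrightarrow> P q \<Longrightarrow> P (p * q)"
  shows "P (p :: ('x, 'k::comm_ring_1) mpoly)"
proof -
  have 0: "P 0" and 1: "P 1" using assms(1)[of 0] assms(1)[of 1] by (simp_all add: Const_def)
  have sum: "P (\<Sum>a\<in>A. g a)" if "\<And>a. a \<in> A \<Longrightarrow> P (g a)" for A and g :: "('x \<Rightarrow>\<^sub>0 nat) \<Rightarrow> ('x, 'k) mpoly"
    using that by (induction A rule: infinite_finite_induct) (auto intro: add 0)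
  have prod: "P (\<Prod>a\<in>A. g a)" if "\<And>a. a \<in> A \<Longrightarrow> P (g a)" for A :: "'x set" and g
    using that by (induction A rule: infinite_finite_induct) (auto intro: mult 1)
  have power: "P (g ^ n)" if "P g" for g n
    using that by (induction n) (auto intro: mult 1)
  have "P (alg_hom Var p)"
    unfolding alg_hom_def by (intro sum mult prod power assms)
  then show ?thesis by (simp add: alg_hom_Var_id)
qed

abbreviation eval_at :: "('x \<Rightarrow> 'k) \<Rightarrow> ('x, 'k::comm_ring_1) mpoly \<Rightarrow> 'k" where
  "eval_at \<equiv> eval_mpoly (\<lambda>c. c)"

lemma eval_at_alg_hom: "eval_at z (alg_hom f p) = eval_at (\<lambda>i. eval_at z (f i)) p"
  using hom_eval_mpoly[OF eval_mpoly_hom[OF id_hom, of z], of Const f p]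
  by (simp add: alg_hom_eq_eval id_hom)

lemma lookup_Const_mult: "Poly_Mapping.lookup (Const c * p) m = c * Poly_Mapping.lookup p m"
  unfolding Const_def mult_map_scale_conv_mult[symmetric]
  by (simp add: Poly_Mapping.map.rep_eq when_def)

lemma lookup_rescaled_variables:
  "Poly_Mapping.lookup (alg_hom (\<lambda>i. Const (s i) * Var i) p) m = Poly_Mapping.lookup p m * monom_value s m"
proof -
  have mv: "monom_value (\<lambda>i. Const (s i) * Var i) n = Const (monom_value s n) * monom_value Var n" for n
    by (simp add: monom_value_def power_mult_distrib prod.distrib
        ring_hom_prod[OF Const_hom] ring_hom_power[OF Const_hom])
  have "alg_hom (\<lambda>i. Const (s i) * Var i) p
    = (\<Sum>n\<in>Poly_Mapping.keys p. Poly_Mapping.single n (Poly_Mapping.lookup p n * monom_value s n))"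
    by (simp add: alg_hom_eq_eval eval_mpoly_def mv mult.assoc[symmetric]
        flip: ring_hom_mult[OF Const_hom] Const_mult_monomial)
  then show ?thesis by (simp add: lookup_sum lookup_single when_def in_keys_iff)
qed

lemma two_power_inj: "(2 :: 'k::field_char_0) ^ a = 2 ^ b \<longleftrightarrow> a = b"
proof
  assume "(2 :: 'k) ^ a = 2 ^ b"
  then have "of_nat (2 ^ a) = (of_nat (2 ^ b) :: 'k)" by (simp only: of_nat_power of_nat_numeral)
  then have "(2::nat) ^ a = 2 ^ b" by (simp only: of_nat_eq_iff)
  then show "a = b" by simp
qed simp

text \<open>Artin's argument for the independence of characters.  If two distinct monomials occur in a polynomial
vanishing everywhere, choose a variable in which their degrees differ.  Doubling that variable multiplies each
monomial by a power of \<open>2\<close>, so subtracting a multiple of the polynomial cancels one of the two monomials and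
keeps the other, and the difference vanishes everywhere and has fewer monomials.\<close>
lemma mpoly_eq_0_if_eval_0:
  fixes p :: "('x, 'k::field_char_0) mpoly"
  assumes "\<And>z. eval_at z p = 0"
  shows "p = 0"
  using assms
proof (induction "card (Poly_Mapping.keys p)" arbitrary: p rule: less_induct)
  case less
  show ?case
  proof (rule ccontr)
    assume "p \<noteq> 0"
    then have "\<exists>n. Poly_Mapping.lookup p n \<noteq> 0" using poly_mapping_eqI[of p 0] by auto
    then obtain n where n: "n \<in> Poly_Mapping.keys p" by (auto simp: in_keys_iff)
    have "\<exists>m\<in>Poly_Mapping.keys p. m \<noteq> n"
    proof (rule ccontr)
      assume "\<not> ?thesis"
      with n have k: "Poly_Mapping.keys p = {n}" by blast
      have "eval_at (\<lambda>_. 1) p = Poly_Mapping.lookup p n"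
        by (simp add: eval_mpoly_def k monom_value_def)
      with less.prems[of "\<lambda>_. 1"] n show False by (simp add: in_keys_iff)
    qed
    then obtain m where m: "m \<in> Poly_Mapping.keys p" "m \<noteq> n" by auto
    then obtain i where i: "Poly_Mapping.lookup m i \<noteq> Poly_Mapping.lookup n i"
      using poly_mapping_eqI[of m n] m(2) by blast
    let ?s = "\<lambda>j. if j = i then 2 else (1::'k)"
    have s: "monom_value ?s l = 2 ^ Poly_Mapping.lookup l i" for l :: "'x \<Rightarrow>\<^sub>0 nat"
    proof (cases "i \<in> Poly_Mapping.keys l")
      case True
      have "monom_value ?s l = (\<Prod>j\<in>Poly_Mapping.keys l. if j = i then 2 ^ Poly_Mapping.lookup l i else 1)"
        unfolding monom_value_def by (rule prod.cong) auto
      with True show ?thesis by simp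
    next
      case False
      then have "monom_value ?s l = (\<Prod>j\<in>Poly_Mapping.keys l. 1)"
        unfolding monom_value_def by (intro prod.cong) auto
      with False show ?thesis by (simp add: in_keys_iff)
    qed
    define q where "q = alg_hom (\<lambda>j. Const (?s j) * Var j) p - Const (2 ^ Poly_Mapping.lookup m i) * p"
    have lq: "Poly_Mapping.lookup q l
        = Poly_Mapping.lookup p l * (2 ^ Poly_Mapping.lookup l i - 2 ^ Poly_Mapping.lookup m i)" for l
      unfolding q_def lookup_minus lookup_rescaled_variables s lookup_Const_mult
      by (simp add: algebra_simps)
    have "Poly_Mapping.keys q \<subseteq> Poly_Mapping.keys p - {m}"
      by (auto simp: in_keys_iff lq)
    with m(1) have "card (Poly_Mapping.keys q) < card (Poly_Mapping.keys p)"
      by (intro psubset_card_mono) auto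
    moreover have "eval_at z q = 0" for z
      unfolding q_def ring_hom_diff[OF eval_mpoly_hom[OF id_hom]] ring_hom_mult[OF eval_mpoly_hom[OF id_hom]]
        eval_at_alg_hom
      by (simp add: less.prems)
    ultimately have "q = 0" by (rule less.hyps)
    then have "Poly_Mapping.lookup p n * (2 ^ Poly_Mapping.lookup n i - 2 ^ Poly_Mapping.lookup m i) = 0"
      using lq[of n] by simp
    then show False using n i by (auto simp: in_keys_iff two_power_inj)
  qed
qed

lemma mpoly_eqI:
  fixes p :: "('x, 'k::field_char_0) mpoly"
  assumes "\<And>z. eval_at z p = eval_at z q"
  shows "p = q"
  using mpoly_eq_0_if_eval_0[of "p - q"] assms by (simp add: ring_hom_diff[OF eval_mpoly_hom[OF id_hom]])

section \<open>Linear orders on the variables\<close>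

text \<open>Any linear order on the variables yields a monomial order, and comparing leading monomials makes the
polynomial ring over a field an integral domain.\<close>
fun gen_index :: "gen \<Rightarrow> nat" where
  "gen_index G_X = 0" | "gen_index G_Y = 1" | "gen_index G_xx = 2" | "gen_index G_xy = 3"
| "gen_index G_yy = 4" | "gen_index G_xxx = 5" | "gen_index G_xxy = 6" | "gen_index G_xyy = 7"
| "gen_index G_yyy = 8" | "gen_index G_v = 9" | "gen_index G_w = 10"

lemma gen_index_inj: "gen_index a = gen_index b \<Longrightarrow> a = b"
  by (cases a; cases b) simp_all

instantiation gen :: linorder
begin
definition less_eq_gen :: "gen \<Rightarrow> gen \<Rightarrow> bool" where "a \<le> b \<longleftrightarrow> gen_index a \<le> gen_index b"
definition less_gen :: "gen \<Rightarrow> gen \<Rightarrow> bool" where "a < b \<longleftrightarrow> gen_index a < gen_index b"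
instance by standard (auto simp: less_eq_gen_def less_gen_def gen_index_inj)
end

fun entry_index :: "entry \<Rightarrow> bool \<times> 3 \<times> 3" where
  "entry_index (X_entry i j) = (False, i, j)" | "entry_index (Y_entry i j) = (True, i, j)"

instantiation entry :: linorder
begin
definition less_eq_entry :: "entry \<Rightarrow> entry \<Rightarrow> bool" where
  "a \<le> b \<longleftrightarrow> (case (entry_index a, entry_index b) of ((s, i, j), (t, k, l)) \<Rightarrow>
     s < t \<or> (s = t \<and> (i < k \<or> (i = k \<and> j \<le> l))))"
definition less_entry :: "entry \<Rightarrow> entry \<Rightarrow> bool" where "a < b \<longleftrightarrow> a \<le> b \<and> \<not> b \<le> (a::entry)"
instance
proof
  fix a b c :: entry
  show "a \<le> a" "a < b \<longleftrightarrow> a \<le> b \<and> \<not> b \<le> a" "a \<le> b \<or> b \<le> a"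
    by (cases a; cases b; force simp: less_eq_entry_def less_entry_def)+
  show "a = b" if "a \<le> b" "b \<le> a"
    using that by (cases a; cases b) (auto simp: less_eq_entry_def)
  show "a \<le> c" if "a \<le> b" "b \<le> c"
    using that by (cases a; cases b; cases c) (auto simp: less_eq_entry_def)
qed
end

section \<open>Traces as functions of two matrices\<close>

definition entry_value :: "'a^3^3 \<Rightarrow> 'a^3^3 \<Rightarrow> entry \<Rightarrow> 'a" where
  "entry_value X Y e = (case e of X_entry p q \<Rightarrow> X $ p $ q | Y_entry p q \<Rightarrow> Y $ p $ q)"

lemma entry_value_simps [simp]:
  "entry_value X Y (X_entry p q) = X $ p $ q" "entry_value X Y (Y_entry p q) = Y $ p $ q"
  by (simp_all add: entry_value_def)

lemma entry_value_surj: "entry_value (\<chi> p q. z (X_entry p q)) (\<chi> p q. z (Y_entry p q)) = z"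
proof
  show "entry_value (\<chi> p q. z (X_entry p q)) (\<chi> p q. z (Y_entry p q)) e = z e" for e
    by (cases e) simp_all
qed

text \<open>Over a polynomial ring the scalar \<open>1/3\<close> is a constant polynomial, over the field it is a number; the
parameter \<open>\<theta>\<close> stands for either.\<close>
definition traceless_by :: "'a::comm_ring_1 \<Rightarrow> 'a^3^3 \<Rightarrow> 'a^3^3" where
  "traceless_by \<theta> Z = Z - mat (\<theta> * trace Z)"

fun generator_value :: "'a::comm_ring_1 \<Rightarrow> 'a^3^3 \<Rightarrow> 'a^3^3 \<Rightarrow> gen \<Rightarrow> 'a" where
  "generator_value \<theta> X Y G_X = trace X"
| "generator_value \<theta> X Y G_Y = trace Y"
| "generator_value \<theta> X Y G_xx = (let x = traceless_by \<theta> X in trace (x ** x))"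
| "generator_value \<theta> X Y G_xy = (let x = traceless_by \<theta> X; y = traceless_by \<theta> Y in trace (x ** y))"
| "generator_value \<theta> X Y G_yy = (let y = traceless_by \<theta> Y in trace (y ** y))"
| "generator_value \<theta> X Y G_xxx = (let x = traceless_by \<theta> X in trace (x ** x ** x))"
| "generator_value \<theta> X Y G_xxy = (let x = traceless_by \<theta> X; y = traceless_by \<theta> Y in trace (x ** x ** y))"
| "generator_value \<theta> X Y G_xyy = (let x = traceless_by \<theta> X; y = traceless_by \<theta> Y in trace (x ** y ** y))"
| "generator_value \<theta> X Y G_yyy = (let y = traceless_by \<theta> Y in trace (y ** y ** y))"
| "generator_value \<theta> X Y G_v = (let x = traceless_by \<theta> X; y = traceless_by \<theta> Y in
     trace (x ** x ** y ** y) - trace (x ** y ** x ** y))"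
| "generator_value \<theta> X Y G_w = (let x = traceless_by \<theta> X; y = traceless_by \<theta> Y in
     trace (x ** x ** y ** y ** x ** y) - trace (y ** y ** x ** x ** y ** x))"

lemma generator_eq_generator_value: "generator G = generator_value (Const (1/3)) X_mat Y_mat G"
  by (cases G) (simp_all add: Let_def x_mat_def y_mat_def traceless_part_def traceless_by_def)

context
  fixes h :: "'a::comm_ring_1 \<Rightarrow> 'b::comm_ring_1"
  assumes h: "is_ring_hom h"
begin

lemma map_matrix_mult: "map_matrix h (A ** B) = map_matrix h A ** map_matrix h B"
  by (simp add: vec_eq_iff matrix_matrix_mult_def ring_hom_simps[OF h])

lemma map_matrix_diff: "map_matrix h (A - B) = map_matrix h A - map_matrix h B"
  by (simp add: vec_eq_iff ring_hom_simps[OF h])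

lemma map_matrix_mat: "map_matrix h (mat c) = mat (h c)"
  by (simp add: vec_eq_iff mat_def ring_hom_simps[OF h])

lemma trace_map_matrix: "trace (map_matrix h A) = h (trace A)"
  by (simp add: trace_def ring_hom_simps[OF h])

lemma map_matrix_traceless: "map_matrix h (traceless_by \<theta> Z) = traceless_by (h \<theta>) (map_matrix h Z)"
  by (simp add: traceless_by_def map_matrix_diff map_matrix_mat trace_map_matrix ring_hom_simps[OF h])

lemma hom_generator_value: "h (generator_value \<theta> X Y G) = generator_value (h \<theta>) (map_matrix h X) (map_matrix h Y) G"
  by (cases G) (simp_all add: Let_def ring_hom_simps[OF h]
      flip: trace_map_matrix map_matrix_mult map_matrix_traceless)

end

lemma map_matrix_X_mat: "is_ring_hom h \<Longrightarrow> map_matrix h X_mat = (\<chi> p q. h (Var (X_entry p q)))"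
  and map_matrix_Y_mat: "is_ring_hom h \<Longrightarrow> map_matrix h Y_mat = (\<chi> p q. h (Var (Y_entry p q)))"
  by (simp_all add: vec_eq_iff X_mat_def Y_mat_def)

lemma alg_hom_generator:
  "alg_hom (entry_value X Y) (generator G) = generator_value (Const (1/3)) X Y G"
proof -
  have "map_matrix (alg_hom (entry_value X Y)) X_mat = X"
       "map_matrix (alg_hom (entry_value X Y)) Y_mat = Y"
    by (simp_all add: map_matrix_X_mat map_matrix_Y_mat alg_hom_hom vec_eq_iff)
  then show ?thesis by (simp add: generator_eq_generator_value hom_generator_value[OF alg_hom_hom])
qed

lemma eval_at_generator: "eval_at (entry_value X Y) (generator G) = generator_value (1/3) X Y G"
proof -
  have *: "is_ring_hom (eval_at (entry_value X Y))" by (simp add: eval_mpoly_hom id_hom)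
  have "map_matrix (eval_at (entry_value X Y)) X_mat = X"
       "map_matrix (eval_at (entry_value X Y)) Y_mat = Y"
    by (simp_all add: map_matrix_X_mat[OF *] map_matrix_Y_mat[OF *] vec_eq_iff id_hom)
  then show ?thesis by (simp add: generator_eq_generator_value hom_generator_value[OF *] id_hom)
qed

lemma GL3_act_eq: "GL3_act g = alg_hom (entry_value (conjugate g X_mat) (conjugate g Y_mat))"
  by (simp add: GL3_act_def entry_value_def[abs_def])

lemma const_matrix_eq: "const_matrix g = map_matrix Const g"
  by (simp add: const_matrix_def map_matrix_def)

lemma eval_at_conjugate:
  "map_matrix (eval_at (entry_value X Y)) (conjugate g Z)
     = g ** map_matrix (eval_at (entry_value X Y)) Z ** matrix_inv g"
proof -
  have *: "is_ring_hom (eval_at (entry_value X Y))" by (simp add: eval_mpoly_hom id_hom)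
  have "map_matrix (eval_at (entry_value X Y)) (const_matrix g) = g" for g
    by (simp add: const_matrix_def vec_eq_iff id_hom)
  then show ?thesis by (simp add: conjugate_def map_matrix_mult[OF *])
qed

text \<open>Evaluating the transformed polynomial is the same as evaluating the polynomial at the conjugated pair: all
that follows about the action is read off from values at pairs of matrices over \<open>K\<close>.\<close>
lemma eval_at_GL3_act:
  "eval_at (entry_value X Y) (GL3_act g f)
     = eval_at (entry_value (g ** X ** matrix_inv g) (g ** Y ** matrix_inv g)) f"
proof -
  let ?h = "eval_at (entry_value X Y)"
  have *: "is_ring_hom ?h" by (simp add: eval_mpoly_hom id_hom)
  have m: "map_matrix ?h X_mat = X" "map_matrix ?h Y_mat = Y"
    by (simp_all add: map_matrix_X_mat[OF *] map_matrix_Y_mat[OF *] vec_eq_iff id_hom)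
  have "?h (entry_value (conjugate g X_mat) (conjugate g Y_mat) e)
     = entry_value (g ** X ** matrix_inv g) (g ** Y ** matrix_inv g) e" for e
    using eval_at_conjugate[of X Y g X_mat, unfolded m] eval_at_conjugate[of X Y g Y_mat, unfolded m]
    by (cases e) (simp_all flip: nth_map_matrix[of ?h])
  then show ?thesis by (simp add: GL3_act_eq eval_at_alg_hom)
qed

lemma matrix_inv_inverse:
  assumes "invertible A"
  shows "A ** matrix_inv A = mat 1" "matrix_inv A ** A = mat 1"
  using someI_ex[OF assms[unfolded invertible_def]] by (simp_all add: matrix_inv_def)

lemma matrix_inv_eqI:
  assumes "P ** Q = mat 1" "Q ** P = mat 1"
  shows "matrix_inv P = Q"
proof -
  have inv: "invertible P" using assms by (auto simp: invertible_def)
  have "matrix_inv P = matrix_inv P ** (P ** Q)" by (simp add: assms)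
  also have "\<dots> = Q" using matrix_inv_inverse(2)[OF inv] by (simp add: matrix_mul_assoc)
  finally show ?thesis .
qed

lemma eval_at_C32:
  fixes f :: "'k::field_char_0 Omega"
  assumes "f \<in> C32" "P ** Q = mat 1" "Q ** P = mat 1"
  shows "eval_at (entry_value (P ** X ** Q) (P ** Y ** Q)) f = eval_at (entry_value X Y) f"
proof -
  have inv: "invertible P" using assms(2,3) by (auto simp: invertible_def)
  have "matrix_inv P = Q" by (rule matrix_inv_eqI[OF assms(2,3)])
  then show ?thesis
    using eval_at_GL3_act[of X Y P f] assms(1) inv by (simp add: C32_def)
qed

lemma mat_mult_commute: "(A :: 'a::comm_ring_1^3^3) ** mat c = mat c ** A"
  by (simp add: vec_eq_iff matrix_matrix_mult_def mat_def sum_3 forall_3 mult.commute)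

lemma conjugate_mult: 
  fixes P Q A B :: "'a::comm_ring_1^3^3"
  assumes "Q ** P = mat 1"
  shows "(P ** A ** Q) ** (P ** B ** Q) = P ** (A ** B) ** Q"
proof -
  have "(P ** A ** Q) ** (P ** B ** Q) = P ** A ** (Q ** P) ** B ** Q"
    by (simp only: matrix_mul_assoc)
  then show ?thesis by (simp add: assms matrix_mul_assoc)
qed

lemma trace_conj:
  fixes P Q A :: "'a::comm_ring_1^3^3"
  assumes "Q ** P = mat 1"
  shows "trace (P ** A ** Q) = trace A"
  using trace_mul_sym[of "P ** A" Q] by (simp add: assms matrix_mul_assoc)

lemma traceless_conj:
  fixes P Q A :: "'a::comm_ring_1^3^3"
  assumes "P ** Q = mat 1" "Q ** P = mat 1"
  shows "traceless_by \<theta> (P ** A ** Q) = P ** traceless_by \<theta> A ** Q"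
proof -
  have "P ** mat c ** Q = mat c" for c
    unfolding mat_mult_commute by (simp add: assms flip: matrix_mul_assoc)
  moreover have "P ** (A - B) ** Q = P ** A ** Q - P ** B ** Q" for B
    by (simp add: vec_eq_iff matrix_matrix_mult_def sum_3 algebra_simps)
  ultimately show ?thesis by (simp add: traceless_by_def trace_conj[OF assms(2)])
qed

lemma generator_value_conj:
  fixes P Q X Y :: "'a::comm_ring_1^3^3"
  assumes "P ** Q = mat 1" "Q ** P = mat 1"
  shows "generator_value \<theta> (P ** X ** Q) (P ** Y ** Q) G = generator_value \<theta> X Y G"
  by (cases G) (simp_all add: Let_def traceless_conj[OF assms] conjugate_mult[OF assms(2)]
      trace_conj[OF assms(2)])

lemma generator_in_C32: "(generator G :: 'k::field_char_0 Omega) \<in> C32"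
proof -
  have "GL3_act g (generator G) = generator G" if "invertible g" for g :: "'k^3^3"
  proof -
    have "const_matrix g ** const_matrix (matrix_inv g) = mat 1"
         "const_matrix (matrix_inv g) ** const_matrix g = mat 1"
      by (simp_all add: const_matrix_eq matrix_inv_inverse[OF that] map_matrix_mat[OF Const_hom]
          ring_hom_1[OF Const_hom] flip: map_matrix_mult[OF Const_hom])
    from generator_value_conj[OF this] show ?thesis
      by (simp add: GL3_act_eq alg_hom_generator conjugate_def) (simp add: generator_eq_generator_value)
  qed
  then show ?thesis by (simp add: C32_def)
qed

lemma C32_Const: "Const c \<in> C32"
  and C32_add: "f \<in> C32 \<Longrightarrow> g \<in> C32 \<Longrightarrow> f + g \<in> C32"
  and C32_diff: "f \<in> C32 \<Longrightarrow> g \<in> C32 \<Longrightarrow> f - g \<in> C32"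
  and C32_mult: "f \<in> C32 \<Longrightarrow> g \<in> C32 \<Longrightarrow> f * g \<in> C32"
  and C32_power: "f \<in> C32 \<Longrightarrow> f ^ n \<in> C32"
  by (simp_all add: C32_def GL3_act_eq ring_hom_simps[OF alg_hom_hom])

abbreviation (input) trace_algebra :: "'k::field_char_0 Omega set" where
  "trace_algebra \<equiv> range (alg_hom generator)"

lemma trace_algebra_subset_C32: "alg_hom generator P \<in> C32"
  by (induction P rule: mpoly_induct)
    (simp_all add: C32_Const C32_add C32_mult generator_in_C32 ring_hom_simps[OF alg_hom_hom])

lemma trace_algebra_Const: "Const c \<in> trace_algebra"
  and trace_algebra_generator: "generator G \<in> trace_algebra"
  and trace_algebra_add: "f \<in> trace_algebra \<Longrightarrow> g \<in> trace_algebra \<Longrightarrow> f + g \<in> trace_algebra"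
  and trace_algebra_mult: "f \<in> trace_algebra \<Longrightarrow> g \<in> trace_algebra \<Longrightarrow> f * g \<in> trace_algebra"
proof -
  show "Const c \<in> trace_algebra" by (rule range_eqI[of _ _ "Const c"]) simp
  show "generator G \<in> trace_algebra" by (rule range_eqI[of _ _ "Var G"]) simp
  show "f \<in> trace_algebra \<Longrightarrow> g \<in> trace_algebra \<Longrightarrow> f + g \<in> trace_algebra"
    "f \<in> trace_algebra \<Longrightarrow> g \<in> trace_algebra \<Longrightarrow> f * g \<in> trace_algebra"
    by (auto simp flip: ring_hom_add[OF alg_hom_hom] ring_hom_mult[OF alg_hom_hom])
qed

lemma generated_subalgebra_range: "generated_subalgebra (range f) = range (alg_hom f)"
proof
  have "is_subalgebra (range (alg_hom f))"
    unfolding is_subalgebra_def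
    by (auto simp flip: ring_hom_add[OF alg_hom_hom] ring_hom_mult[OF alg_hom_hom])
      (metis alg_hom_Const rangeI)
  moreover have "range f \<subseteq> range (alg_hom f)" by (metis alg_hom_Var image_subsetI rangeI)
  ultimately show "generated_subalgebra (range f) \<subseteq> range (alg_hom f)"
    unfolding generated_subalgebra_def by blast
  show "range (alg_hom f) \<subseteq> generated_subalgebra (range f)"
  proof clarify
    fix p show "alg_hom f p \<in> generated_subalgebra (range f)"
      by (induction p rule: mpoly_induct)
        (auto simp: generated_subalgebra_def is_subalgebra_def ring_hom_simps[OF alg_hom_hom])
  qed
qed

section \<open>Density of the conjugates of diagonal matrices\<close>

lemma const_poly_hom: "is_ring_hom (\<lambda>c. [:c:])"
  by (rule is_ring_homI) simp_all

lemma poly_eval_hom: "is_ring_hom (\<lambda>p. poly p t)"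
  by (rule is_ring_homI) simp_all

text \<open>Along a polynomial curve \<open>q\<close> a polynomial becomes univariate, hence vanishes as soon as it has infinitely
many zeros.\<close>
lemma eval_at_zero_along_polynomial_curve:
  fixes Q :: "('x, 'k::field_char_0) mpoly"
  assumes "infinite {t. eval_at (\<lambda>i. poly (q i) t) Q = 0}"
  shows "eval_at (\<lambda>i. poly (q i) t) Q = 0"
proof -
  let ?q = "eval_mpoly (\<lambda>c. [:c:]) q Q"
  have *: "poly ?q t = eval_at (\<lambda>i. poly (q i) t) Q" for t
    using hom_eval_mpoly[OF poly_eval_hom[of t], of "\<lambda>c. [:c:]" q Q] by simp
  have "?q = 0"
    using assms poly_roots_finite[of ?q] unfolding *[symmetric] by blast
  then show ?thesis using *[of t] by simp
qed

lemma infinite_range_poly: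
  fixes q :: "'k::field_char_0 poly"
  assumes "degree q \<noteq> 0"
  shows "infinite (range (poly q))"
proof
  assume fin: "finite (range (poly q))"
  have "finite {x. poly q x = c}" for c
  proof -
    have "q - [:c:] \<noteq> 0" using assms by auto
    from poly_roots_finite[OF this] show ?thesis by simp
  qed
  then have "finite (\<Union>c\<in>range (poly q). {x. poly q x = c})" using fin by blast
  moreover have "(\<Union>c\<in>range (poly q). {x. poly q x = c}) = UNIV" by auto
  ultimately show False using infinite_UNIV_char_0 by metis
qed

definition triple :: "'a \<Rightarrow> 'a \<Rightarrow> 'a \<Rightarrow> 3 \<Rightarrow> 'a" where
  "triple x y z i = (if i = 1 then x else if i = 2 then y else z)"

lemma triple_simps [simp]: "triple x y z 1 = x" "triple x y z 2 = y" "triple x y z 3 = z"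
  by (simp_all add: triple_def)

lemma triple_surj: "triple (z 1) (z 2) (z 3) = z"
  by (simp add: fun_eq_iff forall_3)

text \<open>The roots are released one at a time.  With a root \<open>a\<close> and the sum \<open>s\<close> of the other two fixed, the product
\<open>b (s - b)\<close> of these takes infinitely many values, so \<open>Q\<close> vanishes at every cubic with a root in the field.  With
the first two coefficients fixed, the third is determined by the root \<open>a\<close> and takes infinitely many values, so \<open>Q\<close>
vanishes everywhere.\<close>
lemma elementary_symmetric_independent:
  fixes Q :: "(3, 'k::field_char_0) mpoly"
  assumes zero: "\<And>a b c. eval_at (triple (a + b + c) (a*b + a*c + b*c) (a*b*c)) Q = 0"
  shows "Q = 0"
proof (rule mpoly_eq_0_if_eval_0)
  have quadratic: "eval_at (triple (a + s) (a * s + p) (a * p)) Q = 0" for a s p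
  proof -
    let ?q = "triple [:a + s:] [:a * s, 1:] [:0, a:]"
    have tr: "(\<lambda>i. poly (?q i) t) = triple (a + s) (a * s + t) (a*t)" for t
      by (simp add: fun_eq_iff forall_3)
    have "range (poly [:0, s, -1:]) \<subseteq> {t. eval_at (\<lambda>i. poly (?q i) t) Q = 0}"
      using zero[of a b "s - b" for b] unfolding tr by (auto simp: algebra_simps)
    moreover have "infinite (range (poly [:0, s, -1:]))" by (rule infinite_range_poly) simp
    ultimately have "infinite {t. eval_at (\<lambda>i. poly (?q i) t) Q = 0}" by (rule infinite_super)
    from eval_at_zero_along_polynomial_curve[OF this, of p] show ?thesis unfolding tr .
  qed
  fix z :: "3 \<Rightarrow> 'k"
  let ?q = "triple [:z 1:] [:z 2:] [:0, 1:]"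
  have tr: "(\<lambda>i. poly (?q i) t) = triple (z 1) (z 2) t" for t
    by (simp add: fun_eq_iff forall_3)
  have "range (poly [:0, z 2, - z 1, 1:]) \<subseteq> {t. eval_at (\<lambda>i. poly (?q i) t) Q = 0}"
  proof clarify
    fix a
    show "eval_at (\<lambda>i. poly (?q i) (poly [:0, z 2, - z 1, 1:] a)) Q = 0"
      using quadratic[of a "z 1 - a" "z 2 - a * (z 1 - a)"] unfolding tr by (simp add: algebra_simps)
  qed
  moreover have "infinite (range (poly [:0, z 2, - z 1, 1:]))" by (rule infinite_range_poly) simp
  ultimately have "infinite {t. eval_at (\<lambda>i. poly (?q i) t) Q = 0}" by (rule infinite_super)
  from eval_at_zero_along_polynomial_curve[OF this, of "z 3"] show "eval_at z Q = 0" unfolding tr triple_surj .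
qed

text \<open>The discriminant of \<open>t\<^sup>3 - c\<^sub>1 t\<^sup>2 + c\<^sub>2 t - c\<^sub>3\<close> as a polynomial in the three coefficients.\<close>
definition cubic_disc :: "(3, 'k::field_char_0) mpoly" where
  "cubic_disc = Var 1 ^ 2 * Var 2 ^ 2 - 4 * Var 2 ^ 3 - 4 * Var 1 ^ 3 * Var 3
     + 18 * Var 1 * Var 2 * Var 3 - 27 * Var 3 ^ 2"

lemma eval_cubic_disc: "eval_at (triple x y z) cubic_disc
    = x^2 * y^2 - 4 * y^3 - 4 * x^3 * z + 18 * x * y * z - 27 * z^2"
  by (simp add: cubic_disc_def ring_hom_simps[OF eval_mpoly_hom[OF id_hom]] id_hom)

lemma eval_cubic_disc_at_roots:
  fixes a b c :: "'k::field_char_0"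
  shows "eval_at (triple (a + b + c) (a*b + a*c + b*c) (a*b*c)) cubic_disc = ((b - a) * (c - a) * (c - b)) ^ 2"
  unfolding eval_cubic_disc by algebra

lemma cubic_disc_nonzero: "cubic_disc \<noteq> (0 :: (3, 'k::field_char_0) mpoly)"
proof
  assume "cubic_disc = (0 :: (3, 'k) mpoly)"
  then have "eval_at (triple 0 0 1) cubic_disc = (0 :: 'k)"
    by (simp add: ring_hom_0[OF eval_mpoly_hom[OF id_hom]])
  then show False by (simp add: eval_cubic_disc)
qed

definition matrix3 :: "'a \<Rightarrow> 'a \<Rightarrow> 'a \<Rightarrow> 'a \<Rightarrow> 'a \<Rightarrow> 'a \<Rightarrow> 'a \<Rightarrow> 'a \<Rightarrow> 'a \<Rightarrow> 'a^3^3" where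
  "matrix3 a b c d e f g h i = (\<chi> p q. triple (triple a b c) (triple d e f) (triple g h i) p q)"

abbreviation diag3 :: "'a::zero \<Rightarrow> 'a \<Rightarrow> 'a \<Rightarrow> 'a^3^3" where
  "diag3 a b c \<equiv> matrix3 a 0 0 0 b 0 0 0 c"

text \<open>The matrix with characteristic polynomial \<open>t\<^sup>3 - c\<^sub>1 t\<^sup>2 + c\<^sub>2 t - c\<^sub>3\<close> whose transpose has
\<open>(1, a, a\<^sup>2)\<close> as an eigenvector for each root \<open>a\<close>.\<close>
abbreviation companion :: "'a::comm_ring_1 \<Rightarrow> 'a \<Rightarrow> 'a \<Rightarrow> 'a^3^3" where
  "companion c1 c2 c3 \<equiv> matrix3 0 0 c3  1 0 (-c2)  0 1 c1"

lemma vanishing_transfers_along_conjugation: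
  fixes F :: "'k::field_char_0 Omega"
  assumes "F \<in> C32" "det P \<noteq> 0" "P ** A = B ** P" "\<And>Y. eval_at (entry_value A Y) F = 0"
  shows "eval_at (entry_value B Y) F = 0"
proof -
  have "invertible P" using assms(2) by (simp add: invertible_det_nz)
  then obtain Q where Q: "P ** Q = mat 1" "Q ** P = mat 1" by (auto simp: invertible_def)
  have "P ** A ** Q = B" using Q(1) by (simp add: assms(3) flip: matrix_mul_assoc)
  moreover have "P ** (Q ** Y ** P) ** Q = Y"
  proof -
    have "P ** (Q ** Y ** P) ** Q = (P ** Q) ** Y ** (P ** Q)" by (simp only: matrix_mul_assoc)
    then show ?thesis by (simp add: Q)
  qed
  ultimately show ?thesis
    using eval_at_C32[OF assms(1) Q, of A "Q ** Y ** P"] assms(4) by simp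
qed

text \<open>The Vandermonde matrix of three distinct roots conjugates the companion matrix to a diagonal one, so \<open>F\<close>
vanishes at the companion matrices of split polynomials with distinct roots, and by density at all companion
matrices.  The matrix with columns \<open>e\<^sub>1, X e\<^sub>1, X\<^sup>2 e\<^sub>1\<close> conjugates \<open>X\<close> to its companion matrix wherever its
determinant \<open>\<delta>\<close> does not vanish; hence \<open>\<delta> F = 0\<close>.\<close>
lemma invariant_vanishing_on_diagonal_slice:
  fixes F :: "'k::field_char_0 Omega"
  assumes F: "F \<in> C32" and zero: "\<And>a b c Y. eval_at (entry_value (diag3 a b c) Y) F = 0"
  shows "F = 0"
proof -
  have companion: "eval_at (entry_value (companion c1 c2 c3) Y) F = 0" for c1 c2 c3 Y
  proof -
    define G where
      "G = alg_hom (entry_value (companion (Var 1) (Var 2) (Var 3 :: (3, 'k) mpoly)) (map_matrix Const Y)) F"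
    note hom = eval_mpoly_hom[OF id_hom]
    have G: "eval_at (triple x y z) G = eval_at (entry_value (companion x y z) Y) F" for x y z
    proof -
      have "eval_at (triple x y z) (entry_value (companion (Var 1) (Var 2) (Var 3)) (map_matrix Const Y) e)
          = entry_value (companion x y z) Y e" for e
      proof (cases e)
        case (X_entry p q)
        have "\<forall>p q. eval_at (triple x y z) (companion (Var 1) (Var 2) (Var 3) $ p $ q) = companion x y z $ p $ q"
          by (simp add: forall_3 matrix3_def ring_hom_simps[OF hom] id_hom)
        with X_entry show ?thesis by simp
      qed (simp add: id_hom)
      then show ?thesis by (simp add: G_def eval_at_alg_hom)
    qed
    \<comment> \<open>The factor \<open>cubic_disc\<close> takes care of multiple roots.\<close>
    have "cubic_disc * G = 0"
    proof (rule elementary_symmetric_independent)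
      fix a b c :: 'k
      let ?e = "triple (a + b + c) (a*b + a*c + b*c) (a*b*c)"
      note d = eval_cubic_disc_at_roots[of a b c]
      show "eval_at ?e (cubic_disc * G) = 0"
      proof (cases "eval_at ?e cubic_disc = 0")
        case True
        then show ?thesis by (simp add: ring_hom_simps[OF hom])
      next
        case False
        let ?C = "companion (a + b + c) (a*b + a*c + b*c) (a*b*c)"
        let ?V = "matrix3 1 a (a^2) 1 b (b^2) 1 c (c^2)"
        have det: "det ?V = (b - a) * (c - a) * (c - b)"
          by (simp add: det_3 matrix3_def) algebra
        have VC: "?V ** ?C = diag3 a b c ** ?V"
          by (simp add: vec_eq_iff forall_3 matrix_matrix_mult_def sum_3 matrix3_def)
            (simp add: algebra_simps power2_eq_square)
        then obtain W where W: "?V ** W = mat 1" "W ** ?V = mat 1"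
          using False d det invertible_det_nz[of ?V] by (auto simp: invertible_def)
        have "det W \<noteq> 0" using W(2) det_mul[of W ?V] by auto
        moreover have "W ** diag3 a b c = ?C ** W"
        proof -
          have "W ** diag3 a b c = W ** (diag3 a b c ** ?V) ** W"
            by (simp add: W flip: matrix_mul_assoc)
          also have "\<dots> = (W ** ?V) ** ?C ** W" by (simp only: VC[symmetric] matrix_mul_assoc)
          finally show ?thesis by (simp add: W)
        qed
        ultimately have "eval_at (entry_value ?C Y) F = 0"
          using vanishing_transfers_along_conjugation[OF F _ _ zero] by blast
        then show ?thesis by (simp add: G ring_hom_simps[OF hom])
      qed
    qed
    then have "G = 0" by (simp add: cubic_disc_nonzero)
    then show ?thesis using G[of c1 c2 c3] by (simp add: ring_hom_0[OF hom])
  qed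
  define \<delta> :: "'k Omega" where
    "\<delta> = (let x = \<lambda>p q. Var (X_entry p q) in
       x 2 1 * (x 3 1 * x 1 1 + x 3 2 * x 2 1 + x 3 3 * x 3 1)
       - x 3 1 * (x 2 1 * x 1 1 + x 2 2 * x 2 1 + x 2 3 * x 3 1))"
  note hom = eval_mpoly_hom[OF id_hom]
  have "\<delta> * F = 0"
  proof (rule mpoly_eq_0_if_eval_0)
    fix z :: "entry \<Rightarrow> 'k"
    define X where "X = (\<chi> p q. z (X_entry p q))"
    define Y where "Y = (\<chi> p q. z (Y_entry p q))"
    have z: "z = entry_value X Y" by (simp add: X_def Y_def entry_value_surj)
    let ?x = "\<lambda>p q. X $ p $ q"
    let ?m = "\<lambda>p. ?x p 1 * ?x 1 1 + ?x p 2 * ?x 2 1 + ?x p 3 * ?x 3 1"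
    let ?M = "matrix3 1 (?x 1 1) (?m 1) 0 (?x 2 1) (?m 2) 0 (?x 3 1) (?m 3)"
    have \<delta>: "eval_at z \<delta> = det ?M"
      by (simp add: \<delta>_def Let_def z ring_hom_simps[OF hom] id_hom det_3 matrix3_def algebra_simps)
    show "eval_at z (\<delta> * F) = 0"
    proof (cases "eval_at z \<delta> = 0")
      case True
      then show ?thesis by (simp add: ring_hom_simps[OF hom])
    next
      case False
      let ?c1 = "?x 1 1 + ?x 2 2 + ?x 3 3"
      let ?c2 = "?x 1 1 * ?x 2 2 - ?x 1 2 * ?x 2 1 + ?x 1 1 * ?x 3 3 - ?x 1 3 * ?x 3 1
                 + ?x 2 2 * ?x 3 3 - ?x 2 3 * ?x 3 2"
      have XM: "?M ** companion ?c1 ?c2 (det X) = X ** ?M"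
        by (simp add: vec_eq_iff forall_3 matrix_matrix_mult_def sum_3 matrix3_def det_3)
          (simp add: algebra_simps)
      have "eval_at (entry_value X Y) F = 0"
        by (rule vanishing_transfers_along_conjugation[OF F _ XM companion]) (use False in \<open>simp only: \<delta> not_False_eq_True\<close>)
      then show ?thesis by (simp add: z ring_hom_simps[OF hom])
    qed
  qed
  moreover have "\<delta> \<noteq> 0"
  proof
    assume "\<delta> = 0"
    then have "eval_at (entry_value (matrix3 0 0 0 1 0 0 0 1 0) (mat 0)) \<delta> = 0"
      by (simp add: ring_hom_0[OF hom])
    then show False by (simp add: \<delta>_def Let_def ring_hom_simps[OF hom] id_hom matrix3_def)
  qed
  ultimately show ?thesis by simp
qed

section \<open>The defining relation\<close>

text \<open>The values of the generators at the traceless matrices \<open>x = diag(a, b, c)\<close> and \<open>y\<close> with diagonal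
\<open>d, e, f\<close>.  They depend on the other entries of \<open>y\<close> only through the torus invariants
\<open>p = y\<^sub>2\<^sub>3 y\<^sub>3\<^sub>2\<close>, \<open>q = y\<^sub>1\<^sub>3 y\<^sub>3\<^sub>1\<close>, \<open>r = y\<^sub>1\<^sub>2 y\<^sub>2\<^sub>1\<close>, \<open>s = y\<^sub>1\<^sub>2 y\<^sub>2\<^sub>3 y\<^sub>3\<^sub>1\<close> and
\<open>s' = y\<^sub>1\<^sub>3 y\<^sub>3\<^sub>2 y\<^sub>2\<^sub>1\<close>.\<close>
definition slice_values ::
  "'a::comm_ring_1 \<Rightarrow> 'a \<Rightarrow> 'a \<Rightarrow> 'a \<Rightarrow> 'a \<Rightarrow> 'a \<Rightarrow> 'a \<Rightarrow> 'a \<Rightarrow> 'a \<Rightarrow> 'a \<Rightarrow> 'a \<Rightarrow> gen \<Rightarrow> 'a" where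
  "slice_values a b c d e f p q r s s' G = (case G of
     G_X \<Rightarrow> 0 | G_Y \<Rightarrow> 0
   | G_xx \<Rightarrow> a^2 + b^2 + c^2
   | G_xy \<Rightarrow> a * d + b * e + c * f
   | G_yy \<Rightarrow> d^2 + e^2 + f^2 + 2 * (p + q + r)
   | G_xxx \<Rightarrow> a^3 + b^3 + c^3
   | G_xxy \<Rightarrow> a^2 * d + b^2 * e + c^2 * f
   | G_xyy \<Rightarrow> a * d^2 + b * e^2 + c * f^2 + (b + c) * p + (a + c) * q + (a + b) * r
   | G_yyy \<Rightarrow> d^3 + e^3 + f^3 + 3 * ((e + f) * p + (d + f) * q + (d + e) * r) + 3 * (s + s')
   | G_v \<Rightarrow> (b - c)^2 * p + (a - c)^2 * q + (a - b)^2 * r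
   | G_w \<Rightarrow> (a - b) * (b - c) * (c - a) * (s - s'))"

lemma traces_on_slice:
  fixes a b c d e f y12 y13 y21 y23 y31 y32 :: "'a::idom"
  defines "x \<equiv> diag3 a b c" and "y \<equiv> matrix3 d y12 y13 y21 e y23 y31 y32 f"
    and "t \<equiv> slice_values a b c d e f (y23 * y32) (y13 * y31) (y12 * y21) (y12 * y23 * y31) (y13 * y32 * y21)"
  shows "trace (x ** x) = t G_xx" "trace (x ** y) = t G_xy" "trace (y ** y) = t G_yy"
    "trace (x ** x ** x) = t G_xxx" "trace (x ** x ** y) = t G_xxy"
    "trace (x ** y ** y) = t G_xyy" "trace (y ** y ** y) = t G_yyy"
    "trace (x ** x ** y ** y) - trace (x ** y ** x ** y) = t G_v"
    "trace (x ** x ** y ** y ** x ** y) - trace (y ** y ** x ** x ** y ** x) = t G_w"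
  unfolding x_def y_def t_def slice_values_def
  by (simp_all add: trace_def matrix_matrix_mult_def matrix3_def sum_3, algebra+)

text \<open>The relation multiplied by the common denominator \<open>270\<close> of its coefficients, which makes sense in every
commutative ring.\<close>
definition scaled_relation :: "(gen \<Rightarrow> 'a::comm_ring_1) \<Rightarrow> 'a" where
  "scaled_relation t = 270 * t G_w ^ 2 -
     (10 * w1 t - 60 * w2 t + 72 * w3' t + 3 * w3'' t + 90 * w4 t - 180 * w5 t - 90 * w6 t - 40 * w7 t)"

text \<open>On the slice \<open>w\<close> is the Vandermonde product times \<open>s - s'\<close>, while \<open>s\<close> and \<open>s'\<close> enter the other generators only
through \<open>s + s'\<close>.  As \<open>s s' = p q r\<close>, the square \<open>(s - s')\<^sup>2\<close> is \<open>(s + s')\<^sup>2 - 4 p q r\<close>, and what remains is a polynomial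
identity in eight independent variables.\<close>
lemma scaled_relation_on_slice:
  fixes a b c d e f p q r s s' :: "'a::idom"
  assumes "a + b + c = 0" "d + e + f = 0" "s * s' = p * q * r"
  shows "scaled_relation (slice_values a b c d e f p q r s s') = 0"
proof -
  have c: "c = - a - b" and f: "f = - d - e" using assms by algebra+
  define S where "S = s + s'"
  have S: "(s - s')^2 = S^2 - 4 * (p * q * r)" using assms(3) unfolding S_def by algebra
  show ?thesis
    unfolding scaled_relation_def slice_values_def w1_def w2_def w3'_def w3''_def w4_def w5_def w6_def w7_def
      det_u_def det_D_def det22_def gen.case power_mult_distrib S det_2 det_3
    unfolding S_def[symmetric] c f
    by (simp add: det_2 det_3) algebra
qed

lemma traceless_by_matrix3:
  fixes \<theta> a b c d e f g h i :: "'a::comm_ring_1"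
  defines "m \<equiv> \<theta> * (a + e + i)"
  shows "traceless_by \<theta> (matrix3 a b c d e f g h i) = matrix3 (a - m) b c d (e - m) f g h (i - m)"
  by (simp add: traceless_by_def m_def vec_eq_iff forall_3 matrix3_def mat_def trace_def sum_3)

lemma generator_value_on_slice:
  fixes \<theta> a b c d e f y12 y13 y21 y23 y31 y32 :: "'a::idom"
  defines "m \<equiv> \<theta> * (a + b + c)" and "n \<equiv> \<theta> * (d + e + f)"
  assumes "G \<noteq> G_X" "G \<noteq> G_Y"
  shows "generator_value \<theta> (diag3 a b c) (matrix3 d y12 y13 y21 e y23 y31 y32 f) G
     = slice_values (a - m) (b - m) (c - m) (d - n) (e - n) (f - n)
         (y23 * y32) (y13 * y31) (y12 * y21) (y12 * y23 * y31) (y13 * y32 * y21) G"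
  using assms(3,4) by (cases G)
    (simp_all add: Let_def traceless_by_matrix3 traces_on_slice flip: m_def n_def,
      simp_all add: slice_values_def power2_eq_square power3_eq_cube mult.assoc)

lemma matrix3_surj: "\<exists>a b c d e f g h i. Y = matrix3 a b c d e f g h i"
proof -
  have "Y = matrix3 (Y $ 1 $ 1) (Y $ 1 $ 2) (Y $ 1 $ 3) (Y $ 2 $ 1) (Y $ 2 $ 2) (Y $ 2 $ 3)
      (Y $ 3 $ 1) (Y $ 3 $ 2) (Y $ 3 $ 3)"
    by (simp add: vec_eq_iff forall_3 matrix3_def)
  then show ?thesis by blast
qed

lemma hom_det22: "is_ring_hom h \<Longrightarrow> h (det22 a b c d) = det22 (h a) (h b) (h c) (h d)"
  by (simp add: det22_def det_2 ring_hom_simps)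

lemma hom_det_u: "is_ring_hom h \<Longrightarrow> h (det_u t) = det_u (\<lambda>G. h (t G))"
  by (simp add: det_u_def hom_det22)

lemma hom_det_D: "is_ring_hom h \<Longrightarrow> h (det_D t) = det_D (\<lambda>G. h (t G))"
  by (simp add: det_D_def det_3 ring_hom_simps)

lemma hom_scaled_relation:
  assumes "is_ring_hom h"
  shows "h (scaled_relation t) = scaled_relation (\<lambda>G. h (t G))"
  by (simp add: scaled_relation_def w1_def w2_def w3'_def w3''_def w4_def w5_def w6_def w7_def
      hom_det_u[OF assms] hom_det_D[OF assms] hom_det22[OF assms] ring_hom_simps[OF assms])

lemma Const_numeral: "Const (numeral k) = (numeral k :: ('x, 'k::comm_ring_1) mpoly)"
  by (rule ring_hom_numeral[OF Const_hom])

lemma scaled_relation_Var: "Const 270 * relation = scaled_relation Var"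
proof -
  have *: "Const 270 * (Const c * p) = Const (270 * c) * p" for c :: 'a and p :: "(gen, 'a) mpoly"
    by (simp add: ring_hom_mult[OF Const_hom] mult.assoc)
  show ?thesis
    unfolding relation_def scaled_relation_def right_diff_distrib distrib_left *
    by (simp add: Const_numeral)
qed

lemma Const_inverse_times_numeral:
  "Const (1 / numeral m) * (numeral m * p) = (p :: ('x, 'k::field_char_0) mpoly)"
  unfolding Const_numeral[symmetric] mult.assoc[symmetric] ring_hom_mult[OF Const_hom, symmetric]
  by (simp add: ring_hom_1[OF Const_hom])

lemma numeral_mpoly_neq_0: "(numeral k :: ('x, 'k::field_char_0) mpoly) \<noteq> 0"
proof
  assume *: "(numeral k :: ('x, 'k) mpoly) = 0"
  have "eval_at (\<lambda>_. 0) (numeral k :: ('x, 'k) mpoly) = 0" unfolding * by (simp add: eval_mpoly_def)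
  then show False by (simp add: ring_hom_numeral[OF eval_mpoly_hom[OF id_hom]])
qed

text \<open>The left-hand side is an invariant, so it suffices to know that it vanishes on the slice.\<close>
lemma relation_holds: "alg_hom generator relation = (0 :: 'k::field_char_0 Omega)"
proof -
  note hom = eval_mpoly_hom[OF id_hom]
  have "alg_hom generator (scaled_relation Var) = (0 :: 'k Omega)"
  proof (rule invariant_vanishing_on_diagonal_slice[OF trace_algebra_subset_C32])
    fix a b c :: 'k and Y :: "'k^3^3"
    obtain d y12 y13 y21 e y23 y31 y32 f where Y: "Y = matrix3 d y12 y13 y21 e y23 y31 y32 f"
      using matrix3_surj[of Y] by (elim exE)
    let ?m = "1/3 * (a + b + c)" and ?n = "1/3 * (d + e + f)"
    let ?s = "slice_values (a - ?m) (b - ?m) (c - ?m) (d - ?n) (e - ?n) (f - ?n)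
         (y23 * y32) (y13 * y31) (y12 * y21) (y12 * y23 * y31) (y13 * y32 * y21)"
    have "eval_at (entry_value (diag3 a b c) Y) (alg_hom generator (scaled_relation Var))
        = scaled_relation (generator_value (1/3) (diag3 a b c) Y)"
      by (simp add: eval_at_alg_hom eval_at_generator hom_scaled_relation[OF hom] id_hom)
    also have "\<dots> = scaled_relation ?s"
      unfolding scaled_relation_def w1_def w2_def w3'_def w3''_def w4_def w5_def w6_def w7_def
        det_u_def det_D_def Y by (simp only: generator_value_on_slice gen.distinct not_False_eq_True)
    also have "\<dots> = 0"
      by (rule scaled_relation_on_slice) (simp_all add: field_simps)
    finally show "eval_at (entry_value (diag3 a b c) Y) (alg_hom generator (scaled_relation Var)) = 0" .
  qed
  then have "270 * alg_hom generator relation = (0 :: 'k Omega)"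
    by (simp add: ring_hom_mult[OF alg_hom_hom] ring_hom_numeral[OF alg_hom_hom] Const_numeral flip: scaled_relation_Var)
  then show ?thesis by (simp add: numeral_mpoly_neq_0)
qed

section \<open>Torus weights of invariants\<close>

lemma C32_conjugation:
  fixes f :: "'k::field_char_0 Omega"
  assumes "f \<in> C32" "P ** Q = mat 1" "Q ** P = mat 1"
  shows "alg_hom (entry_value (const_matrix P ** X_mat ** const_matrix Q)
                              (const_matrix P ** Y_mat ** const_matrix Q)) f = f"
proof -
  have inv: "invertible P" using assms(2,3) by (auto simp: invertible_def)
  have "matrix_inv P = Q" by (rule matrix_inv_eqI[OF assms(2,3)])
  moreover have "GL3_act P f = f" using assms(1) inv by (simp add: C32_def)
  ultimately show ?thesis by (simp add: GL3_act_eq conjugate_def)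
qed

definition X_offdiag_free :: "(entry \<Rightarrow>\<^sub>0 nat) \<Rightarrow> bool" where
  "X_offdiag_free m \<longleftrightarrow> (\<forall>i j. i \<noteq> j \<longrightarrow> Poly_Mapping.lookup m (X_entry i j) = 0)"

lemma UNIV_entry:
  "UNIV = (\<lambda>(i, j). X_entry i j) ` UNIV \<union> (\<lambda>(i, j). Y_entry i j) ` UNIV"
proof -
  have "e \<in> (\<lambda>(i, j). X_entry i j) ` UNIV \<union> (\<lambda>(i, j). Y_entry i j) ` UNIV" for e
    by (cases e) auto
  then show ?thesis by (intro set_eqI iffI UNIV_I)
qed

lemma monom_value_entry:
  "monom_value f m = (\<Prod>i\<in>UNIV. \<Prod>j\<in>UNIV. f (X_entry i j) ^ Poly_Mapping.lookup m (X_entry i j))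
     * (\<Prod>i\<in>UNIV. \<Prod>j\<in>UNIV. f (Y_entry i j) ^ Poly_Mapping.lookup m (Y_entry i j))"
proof -
  let ?X = "\<lambda>(i, j). X_entry i j" and ?Y = "\<lambda>(i, j). Y_entry i j"
  let ?g = "\<lambda>e. f e ^ Poly_Mapping.lookup m e"
  have "finite (UNIV :: entry set)" by (subst UNIV_entry) simp
  then have "monom_value f m = prod ?g UNIV" by (simp add: monom_value_superset)
  also have "\<dots> = prod ?g (range ?X) * prod ?g (range ?Y)"
    by (subst UNIV_entry, rule prod.union_disjoint) auto
  also have "prod ?g (range ?X) = (\<Prod>(i, j)\<in>UNIV \<times> UNIV. ?g (X_entry i j))"
    by (subst prod.reindex) (auto simp: inj_on_def case_prod_unfold)
  also have "prod ?g (range ?Y) = (\<Prod>(i, j)\<in>UNIV \<times> UNIV. ?g (Y_entry i j))"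
    by (subst prod.reindex) (auto simp: inj_on_def case_prod_unfold)
  finally show ?thesis by (simp add: prod.cartesian_product)
qed

lemma prod_3: "prod f (UNIV :: 3 set) = f 1 * f 2 * f 3"
  unfolding UNIV_3 by (simp add: ac_simps)

lemma two_power_half_power:
  assumes "(2 :: 'k::field_char_0) ^ a * (1/2) ^ b = 1"
  shows "a = b"
proof -
  have half: "(1/2 :: 'k) ^ b * 2 ^ b = 1"
    unfolding power_mult_distrib[symmetric] by simp
  have "(2 :: 'k) ^ a = 2 ^ a * ((1/2) ^ b * 2 ^ b)" by (simp only: half mult_1_right)
  also have "\<dots> = 2 ^ b" by (simp only: mult.assoc[symmetric] assms mult_1_left)
  finally show ?thesis by (simp only: two_power_inj)
qed

text \<open>Conjugation by \<open>diag(t\<^sub>1, t\<^sub>2, t\<^sub>3)\<close> multiplies the entry in position \<open>(i, j)\<close> by \<open>t\<^sub>i / t\<^sub>j\<close>; here \<open>u\<close> is the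
inverse of \<open>t\<close>.\<close>
lemma torus_scaling:
  fixes f :: "'k::field_char_0 Omega" and t u :: "3 \<Rightarrow> 'k"
  assumes "f \<in> C32" and t: "\<forall>i. t i * u i = 1"
  shows "alg_hom (\<lambda>e. Const (entry_value (\<chi> i j. t i * u j) (\<chi> i j. t i * u j) e) * Var e) f = f"
proof -
  let ?P = "diag3 (t 1) (t 2) (t 3)" and ?Q = "diag3 (u 1) (u 2) (u 3)"
  note t = t[rule_format]
  have u: "u i * t i = 1" for i using t[of i] by (simp only: mult.commute)
  have PQ: "?P ** ?Q = mat 1" "?Q ** ?P = mat 1"
    by (simp_all add: vec_eq_iff forall_3 matrix_matrix_mult_def matrix3_def sum_3 mat_def t u)
  have conj: "const_matrix ?P ** Z ** const_matrix ?Q = (\<chi> i j. Const (t i * u j) * Z $ i $ j)" for Z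
    by (simp add: vec_eq_iff forall_3 matrix_matrix_mult_def matrix3_def sum_3 const_matrix_def
        ring_hom_0[OF Const_hom] ring_hom_mult[OF Const_hom] mult_ac)
  have "entry_value (const_matrix ?P ** X_mat ** const_matrix ?Q)
          (const_matrix ?P ** Y_mat ** const_matrix ?Q) e
      = Const (entry_value (\<chi> i j. t i * u j) (\<chi> i j. t i * u j) e) * Var e" for e
    by (cases e) (simp_all only: conj entry_value_simps vec_lambda_beta X_mat_def Y_mat_def)
  then have "entry_value (const_matrix ?P ** X_mat ** const_matrix ?Q)
          (const_matrix ?P ** Y_mat ** const_matrix ?Q)
      = (\<lambda>e. Const (entry_value (\<chi> i j. t i * u j) (\<chi> i j. t i * u j) e) * Var e)" by (rule ext)
  from C32_conjugation[OF assms(1) PQ, unfolded this] show ?thesis .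
qed

text \<open>A rescaling of the variables multiplies each monomial by a scalar, so a rescaling that fixes \<open>f\<close> has scalar
\<open>1\<close> at every monomial of \<open>f\<close>.\<close>
lemma torus_invariant_monomial:
  fixes f :: "'k::field_char_0 Omega" and t u :: "3 \<Rightarrow> 'k"
  assumes f: "f \<in> C32" and m: "m \<in> Poly_Mapping.keys f" "X_offdiag_free m" and t: "\<forall>i. t i * u i = 1"
  defines "n \<equiv> \<lambda>i j. Poly_Mapping.lookup m (Y_entry i j)"
  shows "(t 1 * u 2) ^ n 1 2 * (t 1 * u 3) ^ n 1 3 * (t 2 * u 1) ^ n 2 1 * (t 2 * u 3) ^ n 2 3
      * (t 3 * u 1) ^ n 3 1 * (t 3 * u 2) ^ n 3 2 = 1"
proof -
  let ?s = "\<lambda>e. entry_value (\<chi> i j. t i * u j) (\<chi> i j. t i * u j) e"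
  have "Poly_Mapping.lookup f m * monom_value ?s m = Poly_Mapping.lookup f m"
    unfolding lookup_rescaled_variables[symmetric] torus_scaling[OF f t] ..
  then have 1: "monom_value ?s m = 1"
    using m(1) unfolding in_keys_iff by (simp only: mult_cancel_left2 simp_thms)
  have offdiag: "Poly_Mapping.lookup m (X_entry 1 2) = 0" "Poly_Mapping.lookup m (X_entry 1 3) = 0"
    "Poly_Mapping.lookup m (X_entry 2 1) = 0" "Poly_Mapping.lookup m (X_entry 2 3) = 0"
    "Poly_Mapping.lookup m (X_entry 3 1) = 0" "Poly_Mapping.lookup m (X_entry 3 2) = 0"
    using m(2) by (simp_all add: X_offdiag_free_def)
  have mv: "monom_value ?s m
      = (t 1 * u 2) ^ n 1 2 * (t 1 * u 3) ^ n 1 3 * (t 2 * u 1) ^ n 2 1 * (t 2 * u 3) ^ n 2 3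
      * (t 3 * u 1) ^ n 3 1 * (t 3 * u 2) ^ n 3 2"
    unfolding monom_value_entry prod_3 entry_value_simps vec_lambda_beta n_def
    by (simp only: offdiag t[rule_format] power_0 power_one mult_1_left mult_1_right mult.assoc)
  show ?thesis unfolding mv[symmetric] by (rule 1)
qed

text \<open>In a monomial of an invariant each index occurs equally often as a row and as a column: conjugation by the
diagonal matrix with one entry \<open>2\<close> and the others \<open>1\<close> multiplies the monomial by \<open>2\<close> to the difference of the two
numbers, and no nontrivial power of \<open>2\<close> equals \<open>1\<close> in characteristic \<open>0\<close>.\<close>
lemma torus_weights:
  fixes f :: "'k::field_char_0 Omega"
  assumes "f \<in> C32" "m \<in> Poly_Mapping.keys f" "X_offdiag_free m"
  defines "n \<equiv> \<lambda>i j. Poly_Mapping.lookup m (Y_entry i j)"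
  shows "n 1 2 + n 1 3 = n 2 1 + n 3 1" "n 2 1 + n 2 3 = n 1 2 + n 3 2" "n 3 1 + n 3 2 = n 1 3 + n 2 3"
proof -
  have inv: "(t 1 * u 2) ^ n 1 2 * (t 1 * u 3) ^ n 1 3 * (t 2 * u 1) ^ n 2 1 * (t 2 * u 3) ^ n 2 3
      * (t 3 * u 1) ^ n 3 1 * (t 3 * u 2) ^ n 3 2 = 1" if t: "\<forall>i. t i * u i = 1" for t u :: "3 \<Rightarrow> 'k"
    unfolding n_def by (rule torus_invariant_monomial[OF assms(1-3) t])
  have 3: "\<forall>i. triple a b c i * triple a' b' c' i = 1"
    if "a * a' = 1" "b * b' = 1" "c * c' = 1" for a b c a' b' c' :: 'k
    using that by (simp add: forall_3)
  have "(2::'k) ^ (n 1 2 + n 1 3) * (1/2) ^ (n 2 1 + n 3 1) = 1"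
    using inv[OF 3[of 2 "1/2" 1 1 1 1]]
    by (simp only: triple_simps mult_1_left mult_1_right power_one power_add mult.assoc) simp
  then show "n 1 2 + n 1 3 = n 2 1 + n 3 1" by (rule two_power_half_power)
  have "(2::'k) ^ (n 2 1 + n 2 3) * (1/2) ^ (n 1 2 + n 3 2) = 1"
    using inv[OF 3[of 1 1 2 "1/2" 1 1]]
    by (simp only: triple_simps mult_1_left mult_1_right power_one power_add mult_ac) simp
  then show "n 2 1 + n 2 3 = n 1 2 + n 3 2" by (rule two_power_half_power)
  have "(2::'k) ^ (n 3 1 + n 3 2) * (1/2) ^ (n 1 3 + n 2 3) = 1"
    using inv[OF 3[of 1 1 1 1 2 "1/2"]]
    by (simp only: triple_simps mult_1_left mult_1_right power_one power_add mult_ac) simp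
  then show "n 3 1 + n 3 2 = n 1 3 + n 2 3" by (rule two_power_half_power)
qed

section \<open>Restriction to the slice\<close>

definition X_diag :: "'k::field_char_0 Omega^3^3" where
  "X_diag = diag3 (Var (X_entry 1 1)) (Var (X_entry 2 2)) (Var (X_entry 3 3))"

definition restrict_slice :: "'k::field_char_0 Omega \<Rightarrow> 'k Omega" where
  "restrict_slice = alg_hom (entry_value X_diag Y_mat)"

lemma restrict_slice_hom: "is_ring_hom restrict_slice"
  by (simp add: restrict_slice_def alg_hom_hom)

lemma X_diag_nth: "X_diag $ i $ j = (if i = j then Var (X_entry i i) else 0)"
proof -
  have "\<forall>i j. X_diag $ i $ j = (if i = j then Var (X_entry i i) else (0 :: 'a Omega))"
    by (simp add: X_diag_def matrix3_def forall_3)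
  then show ?thesis by blast
qed

lemma restrict_slice_injective:
  fixes F :: "'k::field_char_0 Omega"
  assumes "F \<in> C32" "restrict_slice F = 0"
  shows "F = 0"
proof (rule invariant_vanishing_on_diagonal_slice[OF assms(1)])
  fix a b c :: 'k and Y :: "'k^3^3"
  note hom = eval_mpoly_hom[OF id_hom]
  have "eval_at (entry_value (diag3 a b c) Y) (entry_value X_diag Y_mat e) = entry_value (diag3 a b c) Y e" for e
  proof (cases e)
    case (X_entry i j)
    have "\<forall>i j. eval_at (entry_value (diag3 a b c) Y) (X_diag $ i $ j) = diag3 a b c $ i $ j"
      by (simp add: forall_3 X_diag_def matrix3_def id_hom ring_hom_0[OF hom])
    with X_entry show ?thesis by simp
  qed (simp add: Y_mat_def id_hom)
  then have "eval_at (entry_value (diag3 a b c) Y) (restrict_slice F) = eval_at (entry_value (diag3 a b c) Y) F"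
    by (simp add: restrict_slice_def eval_at_alg_hom)
  then show "eval_at (entry_value (diag3 a b c) Y) F = 0"
    by (simp add: assms(2) ring_hom_0[OF hom])
qed

text \<open>The eigenvalues of the traceless part of a diagonal \<open>X\<close>.\<close>
definition eigenvalue :: "3 \<Rightarrow> 'k::field_char_0 Omega" where
  "eigenvalue i = Var (X_entry i i) - Const (1/3) * (Var (X_entry 1 1) + Var (X_entry 2 2) + Var (X_entry 3 3))"

definition y_diag :: "3 \<Rightarrow> 'k::field_char_0 Omega" where
  "y_diag i = Var (Y_entry i i) - Const (1/3) * (Var (Y_entry 1 1) + Var (Y_entry 2 2) + Var (Y_entry 3 3))"

abbreviation y_var :: "3 \<Rightarrow> 3 \<Rightarrow> 'k::field_char_0 Omega" where
  "y_var i j \<equiv> Var (Y_entry i j)"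

lemma three_thirds: "Const (1/3) + (Const (1/3) + Const (1/3)) = (1 :: ('x, 'k::field_char_0) mpoly)"
proof -
  have "Const (1/3) + (Const (1/3) + Const (1/3)) = (Const (1/3 + (1/3 + 1/3)) :: ('x, 'k) mpoly)"
    by (simp only: ring_hom_add[OF Const_hom])
  also have "1/3 + (1/3 + 1/3) = (1 :: 'k)" by simp
  finally show ?thesis by (simp add: ring_hom_1[OF Const_hom])
qed

lemma minus_thirds_sum:
  fixes a b c \<theta> :: "'a::comm_ring_1"
  assumes "\<theta> + (\<theta> + \<theta>) = 1"
  shows "(a - \<theta> * (a + b + c)) + (b - \<theta> * (a + b + c)) + (c - \<theta> * (a + b + c)) = 0"
proof -
  have "(a - \<theta> * (a + b + c)) + (b - \<theta> * (a + b + c)) + (c - \<theta> * (a + b + c))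
      = (a + b + c) * (1 - (\<theta> + (\<theta> + \<theta>)))" by (simp add: algebra_simps)
  also have "\<dots> = 0" by (simp only: assms diff_self mult_zero_right)
  finally show ?thesis .
qed

lemma eigenvalue_sum: "eigenvalue 1 + eigenvalue 2 + eigenvalue 3 = 0"
  and y_diag_sum: "y_diag 1 + y_diag 2 + y_diag 3 = 0"
  unfolding eigenvalue_def y_diag_def by (rule minus_thirds_sum, rule three_thirds)+

lemma restrict_slice_generator:
  assumes "G \<noteq> G_X" "G \<noteq> G_Y"
  shows "(restrict_slice (generator G) :: 'k::field_char_0 Omega) = slice_values (eigenvalue 1) (eigenvalue 2) (eigenvalue 3) (y_diag 1) (y_diag 2) (y_diag 3)
    (y_var 2 3 * y_var 3 2) (y_var 1 3 * y_var 3 1) (y_var 1 2 * y_var 2 1) (y_var 1 2 * y_var 2 3 * y_var 3 1) (y_var 1 3 * y_var 3 2 * y_var 2 1) G"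
proof -
  have Y: "(Y_mat :: 'k Omega^3^3) = matrix3 (y_var 1 1) (y_var 1 2) (y_var 1 3) (y_var 2 1) (y_var 2 2) (y_var 2 3) (y_var 3 1) (y_var 3 2) (y_var 3 3)"
    by (simp add: vec_eq_iff forall_3 matrix3_def Y_mat_def)
  show ?thesis
    unfolding restrict_slice_def alg_hom_generator X_diag_def Y eigenvalue_def y_diag_def
    by (rule generator_value_on_slice[OF assms])
qed

lemma restrict_slice_G_X: "restrict_slice (generator G_X) = Var (X_entry 1 1) + Var (X_entry 2 2) + Var (X_entry 3 3)"
  and restrict_slice_G_Y: "restrict_slice (generator G_Y) = y_var 1 1 + y_var 2 2 + y_var 3 3"
  unfolding restrict_slice_def alg_hom_generator generator_value.simps
  by (simp_all add: trace_def sum_3 X_diag_def Y_mat_def matrix3_def)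

text \<open>The restrictions to the slice of the elements of \<open>A\<close>.\<close>
definition slice_algebra :: "'k::field_char_0 Omega set" where
  "slice_algebra = restrict_slice ` trace_algebra"

lemma slice_algebra_Const: "Const c \<in> slice_algebra"
  and slice_algebra_generator: "restrict_slice (generator G) \<in> slice_algebra"
  and slice_algebra_add: "f \<in> slice_algebra \<Longrightarrow> g \<in> slice_algebra \<Longrightarrow> f + g \<in> slice_algebra"
  and slice_algebra_mult: "f \<in> slice_algebra \<Longrightarrow> g \<in> slice_algebra \<Longrightarrow> f * g \<in> slice_algebra"
proof -
  show "restrict_slice (generator G) \<in> slice_algebra"
    unfolding slice_algebra_def by (rule imageI) (rule trace_algebra_generator)
  show "Const c \<in> slice_algebra"
    unfolding slice_algebra_def
    by (rule image_eqI[of _ _ "Const c"]) (simp add: restrict_slice_def, rule trace_algebra_Const)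
  assume "f \<in> slice_algebra" "g \<in> slice_algebra"
  then obtain f' g' where fg: "f = restrict_slice f'" "g = restrict_slice g'" "f' \<in> trace_algebra" "g' \<in> trace_algebra"
    unfolding slice_algebra_def by blast
  show "f + g \<in> slice_algebra"
    unfolding slice_algebra_def fg(1,2) ring_hom_add[OF restrict_slice_hom, symmetric]
    by (rule imageI) (rule trace_algebra_add[OF fg(3,4)])
  show "f * g \<in> slice_algebra"
    unfolding slice_algebra_def fg(1,2) ring_hom_mult[OF restrict_slice_hom, symmetric]
    by (rule imageI) (rule trace_algebra_mult[OF fg(3,4)])
qed

declare generator.simps [simp del]

section \<open>Localisation at the discriminant\<close>

inductive_set eigenvalue_algebra :: "'k::field_char_0 Omega set" where
  base: "f \<in> slice_algebra \<Longrightarrow> f \<in> eigenvalue_algebra"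
| add: "f \<in> eigenvalue_algebra \<Longrightarrow> g \<in> eigenvalue_algebra \<Longrightarrow> f + g \<in> eigenvalue_algebra"
| eigenvalue: "f \<in> eigenvalue_algebra \<Longrightarrow> eigenvalue i * f \<in> eigenvalue_algebra"

lemma eigenvalue_algebra_scale:
  assumes "c \<in> slice_algebra" "f \<in> eigenvalue_algebra"
  shows "c * f \<in> eigenvalue_algebra"
  using assms(2)
proof induction
  case (base f)
  then show ?case by (intro eigenvalue_algebra.base slice_algebra_mult assms(1))
next
  case (add f g)
  show ?case unfolding distrib_left by (rule eigenvalue_algebra.add[OF add.IH])
next
  case (eigenvalue f i)
  then show ?case unfolding mult.left_commute[of c] by (intro eigenvalue_algebra.eigenvalue)
qed

lemma eigenvalue_algebra_mult:
  assumes "f \<in> eigenvalue_algebra" "g \<in> eigenvalue_algebra"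
  shows "f * g \<in> eigenvalue_algebra"
  using assms(1)
proof induction
  case (base f)
  then show ?case by (intro eigenvalue_algebra_scale assms(2))
next
  case (add f h)
  show ?case unfolding distrib_right by (rule eigenvalue_algebra.add[OF add.IH])
next
  case (eigenvalue f i)
  then show ?case unfolding mult.assoc by (intro eigenvalue_algebra.eigenvalue)
qed

lemma slice_algebra_1: "1 \<in> slice_algebra"
  using slice_algebra_Const[of 1] by (simp add: ring_hom_1[OF Const_hom])

lemma slice_algebra_numeral: "numeral n \<in> slice_algebra"
  using slice_algebra_Const[of "numeral n"] by (simp add: Const_numeral)

lemma slice_algebra_diff:
  assumes "f \<in> slice_algebra" "g \<in> slice_algebra"
  shows "f - g \<in> slice_algebra"
proof -
  have "f - g = f + Const (-1) * g" by (simp add: ring_hom_uminus[OF Const_hom] ring_hom_1[OF Const_hom])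
  then show ?thesis using assms by (simp only: slice_algebra_add slice_algebra_mult slice_algebra_Const)
qed

lemma slice_algebra_power: "f \<in> slice_algebra \<Longrightarrow> f ^ n \<in> slice_algebra"
  by (induction n) (simp_all add: slice_algebra_1 slice_algebra_mult)

text \<open>The discriminant of the characteristic polynomial of \<open>x\<close> is \<open>tr(x\<^sup>2)\<^sup>3 / 2 - 3 tr(x\<^sup>3)\<^sup>2\<close>; division by \<open>-3\<close> makes
it monic in \<open>tr(x\<^sup>3)\<close>.\<close>
definition x_disc :: "(gen \<Rightarrow> ('x, 'k::field_char_0) mpoly) \<Rightarrow> ('x, 'k) mpoly" where
  "x_disc t = t G_xxx ^ 2 - Const (1/6) * t G_xx ^ 3"

definition slice_disc :: "'k::field_char_0 Omega" where
  "slice_disc = x_disc (\<lambda>G. restrict_slice (generator G))"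

lemma slice_disc_in: "slice_disc \<in> slice_algebra"
  unfolding slice_disc_def x_disc_def
  by (intro slice_algebra_diff slice_algebra_mult slice_algebra_power slice_algebra_generator slice_algebra_Const)

lemma slice_disc_vandermonde:
  "((eigenvalue 1 - eigenvalue 2) * (eigenvalue 1 - eigenvalue 3) * (eigenvalue 2 - eigenvalue 3)) ^ 2 = - 3 * (slice_disc :: 'k::field_char_0 Omega)"
proof -
  define a :: "'k Omega" where "a = eigenvalue 1"
  define b :: "'k Omega" where "b = eigenvalue 2"
  have c: "eigenvalue 3 = - a - b" using eigenvalue_sum[where ?'a = 'k] unfolding a_def b_def by algebra
  have sixth: "6 * (Const (1/6) * p) = (p :: 'k Omega)" for p
    using Const_inverse_times_numeral[of "num.Bit0 (num.Bit1 num.One)" p] by (simp add: mult.left_commute)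
  have "6 * (slice_disc :: 'k Omega) = 6 * restrict_slice (generator G_xxx) ^ 2 - restrict_slice (generator G_xx) ^ 3"
    by (simp add: slice_disc_def x_disc_def right_diff_distrib sixth)
  also have "\<dots> = - 2 * ((a - b) * (a - eigenvalue 3) * (b - eigenvalue 3)) ^ 2"
    by (simp add: restrict_slice_generator slice_values_def c flip: a_def b_def) algebra
  finally have "2 * ((a - b) * (a - eigenvalue 3) * (b - eigenvalue 3)) ^ 2 = 2 * (- 3 * slice_disc)" by simp
  then show ?thesis unfolding a_def b_def by (simp add: numeral_mpoly_neq_0)
qed

text \<open>What the eigenvalue algebra becomes when the discriminant of \<open>x\<close> is inverted, intersected with the
polynomial ring: working with the powers of the discriminant avoids fractions.\<close>
definition local_algebra :: "'k::field_char_0 Omega set" where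
  "local_algebra = {f. \<exists>n. slice_disc ^ n * f \<in> eigenvalue_algebra}"

lemma local_algebraI: "slice_disc ^ n * f \<in> eigenvalue_algebra \<Longrightarrow> f \<in> local_algebra"
  by (auto simp: local_algebra_def)

lemma eigenvalue_algebra_local: "f \<in> eigenvalue_algebra \<Longrightarrow> f \<in> local_algebra"
  by (rule local_algebraI[of 0]) simp

lemma slice_algebra_local: "f \<in> slice_algebra \<Longrightarrow> f \<in> local_algebra"
  by (intro eigenvalue_algebra_local eigenvalue_algebra.base)

lemma eigenvalue_disc_power: "f \<in> eigenvalue_algebra \<Longrightarrow> slice_disc ^ n * f \<in> eigenvalue_algebra"
  by (intro eigenvalue_algebra_scale slice_algebra_power slice_disc_in)

lemma local_algebra_mult:
  assumes "f \<in> local_algebra" "g \<in> local_algebra"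
  shows "f * g \<in> local_algebra"
proof -
  obtain m n where "slice_disc ^ m * f \<in> eigenvalue_algebra" "slice_disc ^ n * g \<in> eigenvalue_algebra"
    using assms by (auto simp: local_algebra_def)
  then have "(slice_disc ^ m * f) * (slice_disc ^ n * g) \<in> eigenvalue_algebra" by (rule eigenvalue_algebra_mult)
  then show ?thesis by (intro local_algebraI[of "m + n"]) (simp add: power_add mult_ac)
qed

lemma local_algebra_add:
  assumes "f \<in> local_algebra" "g \<in> local_algebra"
  shows "f + g \<in> local_algebra"
proof -
  obtain m n where "slice_disc ^ m * f \<in> eigenvalue_algebra" "slice_disc ^ n * g \<in> eigenvalue_algebra"
    using assms by (auto simp: local_algebra_def)
  from eigenvalue_algebra.add[OF eigenvalue_disc_power[OF this(1), of n] eigenvalue_disc_power[OF this(2), of m]]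
  have "slice_disc ^ n * (slice_disc ^ m * f) + slice_disc ^ m * (slice_disc ^ n * g) \<in> eigenvalue_algebra" .
  then show ?thesis by (intro local_algebraI[of "m + n"]) (simp add: power_add algebra_simps)
qed

lemma local_algebra_Const: "Const c \<in> local_algebra"
  by (intro slice_algebra_local slice_algebra_Const)

lemma local_algebra_diff:
  assumes "f \<in> local_algebra" "g \<in> local_algebra"
  shows "f - g \<in> local_algebra"
proof -
  have "f - g = f + Const (-1) * g" by (simp add: ring_hom_uminus[OF Const_hom] ring_hom_1[OF Const_hom])
  then show ?thesis using assms by (simp only: local_algebra_add local_algebra_mult local_algebra_Const)
qed

lemma local_algebra_1: "1 \<in> local_algebra"
  by (intro slice_algebra_local slice_algebra_1)

lemma local_algebra_power: "f \<in> local_algebra \<Longrightarrow> f ^ n \<in> local_algebra"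
  by (induction n) (simp_all add: local_algebra_1 local_algebra_mult)

lemma local_algebra_numeral: "numeral n \<in> local_algebra"
  by (intro slice_algebra_local slice_algebra_numeral)

lemma local_algebra_sum: "(\<And>a. a \<in> A \<Longrightarrow> f a \<in> local_algebra) \<Longrightarrow> sum f A \<in> local_algebra"
proof (induction A rule: infinite_finite_induct)
  case (insert a A)
  then show ?case by (simp add: local_algebra_add)
qed (use local_algebra_Const[of 0] in \<open>simp_all add: ring_hom_0[OF Const_hom]\<close>)

lemma local_algebra_eigenvalue: "eigenvalue i \<in> local_algebra"
  using eigenvalue_algebra.eigenvalue[OF eigenvalue_algebra.base[OF slice_algebra_1], of i] by (intro eigenvalue_algebra_local) simp

lemma local_algebra_generator: "restrict_slice (generator G) \<in> local_algebra"
  by (intro slice_algebra_local slice_algebra_generator)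

lemma local_algebra_cancel_Const:
  assumes "Const c * f \<in> local_algebra" "c \<noteq> 0"
  shows "f \<in> local_algebra"
proof -
  have "Const (1/c) * (Const c * f) = f"
    unfolding mult.assoc[symmetric] ring_hom_mult[OF Const_hom, symmetric]
    using assms(2) by (simp add: ring_hom_1[OF Const_hom])
  then show ?thesis using local_algebra_mult[OF local_algebra_Const assms(1)] by metis
qed

lemma local_algebra_cancel_numeral:
  "numeral n * f \<in> local_algebra \<Longrightarrow> f \<in> local_algebra"
  using local_algebra_cancel_Const[of "numeral n"] by (simp add: Const_numeral)

lemma local_algebra_cancel_disc:
  assumes "slice_disc * f \<in> local_algebra"
  shows "f \<in> local_algebra"
proof -
  obtain n where "slice_disc ^ n * (slice_disc * f) \<in> eigenvalue_algebra"
    using assms by (auto simp: local_algebra_def)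
  then show ?thesis by (intro local_algebraI[of "Suc n"]) (simp add: mult_ac)
qed

text \<open>A divisor of the discriminant can be cancelled; \<open>h\<close> is the complementary divisor.\<close>
lemma local_algebra_cancel_vandermonde:
  assumes "g * f \<in> local_algebra" "h \<in> local_algebra"
    "h * g = ((eigenvalue 1 - eigenvalue 2) * (eigenvalue 1 - eigenvalue 3) * (eigenvalue 2 - eigenvalue 3)) ^ 2"
  shows "f \<in> local_algebra"
proof -
  have "h * (g * f) \<in> local_algebra" by (rule local_algebra_mult[OF assms(2,1)])
  also have "h * (g * f) = Const (-3) * (slice_disc * f)"
    unfolding mult.assoc[symmetric] assms(3) slice_disc_vandermonde
    by (simp add: ring_hom_uminus[OF Const_hom] Const_numeral)
  finally have "slice_disc * f \<in> local_algebra" by (rule local_algebra_cancel_Const) simp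
  then show ?thesis by (rule local_algebra_cancel_disc)
qed

text \<open>Three elements are recovered from their moments with respect to the eigenvalues by Lagrange interpolation,
whose denominators divide the discriminant.\<close>
lemma lagrange_interpolation:
  assumes T0: "u1 + u2 + u3 \<in> local_algebra"
    and T1: "eigenvalue 1 * u1 + eigenvalue 2 * u2 + eigenvalue 3 * u3 \<in> local_algebra"
    and T2: "eigenvalue 1 ^ 2 * u1 + eigenvalue 2 ^ 2 * u2 + eigenvalue 3 ^ 2 * u3 \<in> local_algebra"
  shows "u1 \<in> local_algebra" "u2 \<in> local_algebra" "u3 \<in> local_algebra"
proof -
  let ?a = "eigenvalue 1" and ?b = "eigenvalue 2" and ?c = "eigenvalue 3"
  let ?T0 = "u1 + u2 + u3" and ?T1 = "?a * u1 + ?b * u2 + ?c * u3"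
  let ?T2 = "?a ^ 2 * u1 + ?b ^ 2 * u2 + ?c ^ 2 * u3"
  note closed = local_algebra_add local_algebra_diff local_algebra_mult local_algebra_power
    local_algebra_eigenvalue T0 T1 T2
  have "((?a - ?b) * (?a - ?c)) * u1 = ?T2 - (?b + ?c) * ?T1 + ?b * ?c * ?T0" by algebra
  also have "\<dots> \<in> local_algebra" by (intro closed)
  finally show "u1 \<in> local_algebra"
    by (rule local_algebra_cancel_vandermonde[of _ _ "(?a - ?b) * (?a - ?c) * (?b - ?c) ^ 2"])
      ((intro closed)[1], simp add: power_mult_distrib power2_eq_square mult_ac)
  have "((?a - ?b) * (?b - ?c)) * u2 = - (?T2 - (?a + ?c) * ?T1 + ?a * ?c * ?T0)" by algebra
  also have "\<dots> = (?a + ?c) * ?T1 - ?T2 - ?a * ?c * ?T0" by simp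
  also have "\<dots> \<in> local_algebra" by (intro closed)
  finally show "u2 \<in> local_algebra"
    by (rule local_algebra_cancel_vandermonde[of _ _ "(?a - ?b) * (?b - ?c) * (?a - ?c) ^ 2"])
      ((intro closed)[1], simp add: power_mult_distrib power2_eq_square mult_ac)
  have "((?a - ?c) * (?b - ?c)) * u3 = ?T2 - (?a + ?b) * ?T1 + ?a * ?b * ?T0" by algebra
  also have "\<dots> \<in> local_algebra" by (intro closed)
  finally show "u3 \<in> local_algebra"
    by (rule local_algebra_cancel_vandermonde[of _ _ "(?a - ?c) * (?b - ?c) * (?a - ?b) ^ 2"])
      ((intro closed)[1], simp add: power_mult_distrib power2_eq_square mult_ac)
qed

text \<open>The torus invariants are recovered from the generators one after the other.  The moments of the diagonal of
\<open>y\<close> are \<open>0\<close>, \<open>tr(xy)\<close> and \<open>tr(x\<^sup>2y)\<close>.  Once the diagonal is known, \<open>tr(y\<^sup>2)\<close>, \<open>tr(xy\<^sup>2)\<close> and \<open>v\<close> give the moments of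
\<open>p, q, r\<close>.  Then \<open>tr(y\<^sup>3)\<close> gives \<open>s + s'\<close>, and \<open>w\<close>, the Vandermonde product times \<open>s - s'\<close>, gives \<open>s - s'\<close>.\<close>
lemma torus_invariants_local:
  shows "Var (X_entry i i) \<in> (local_algebra :: 'k::field_char_0 Omega set)" "y_var i i \<in> (local_algebra :: 'k::field_char_0 Omega set)"
    "y_var 2 3 * y_var 3 2 \<in> (local_algebra :: 'k::field_char_0 Omega set)" "y_var 1 3 * y_var 3 1 \<in> (local_algebra :: 'k::field_char_0 Omega set)" "y_var 1 2 * y_var 2 1 \<in> (local_algebra :: 'k::field_char_0 Omega set)"
    "y_var 1 2 * y_var 2 3 * y_var 3 1 \<in> (local_algebra :: 'k::field_char_0 Omega set)" "y_var 1 3 * y_var 3 2 * y_var 2 1 \<in> (local_algebra :: 'k::field_char_0 Omega set)"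
proof -
  let ?t = "\<lambda>G. restrict_slice (generator G) :: 'k Omega"
  define a :: "'k Omega" where "a = eigenvalue 1"
  define b :: "'k Omega" where "b = eigenvalue 2"
  define c :: "'k Omega" where "c = eigenvalue 3"
  define d :: "'k Omega" where "d = y_diag 1"
  define e :: "'k Omega" where "e = y_diag 2"
  define f :: "'k Omega" where "f = y_diag 3"
  define p :: "'k Omega" where "p = y_var 2 3 * y_var 3 2"
  define q :: "'k Omega" where "q = y_var 1 3 * y_var 3 1"
  define r :: "'k Omega" where "r = y_var 1 2 * y_var 2 1"
  define s :: "'k Omega" where "s = y_var 1 2 * y_var 2 3 * y_var 3 1"
  define s' :: "'k Omega" where "s' = y_var 1 3 * y_var 3 2 * y_var 2 1"
  note defs = a_def b_def c_def d_def e_def f_def p_def q_def r_def s_def s'_def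
  have t: "?t G = slice_values a b c d e f p q r s s' G" if "G \<noteq> G_X" "G \<noteq> G_Y" for G
    unfolding defs by (rule restrict_slice_generator[OF that])
  have abc: "a + b + c = 0" and def: "d + e + f = 0"
    unfolding defs by (rule eigenvalue_sum y_diag_sum)+
  note closed = local_algebra_add local_algebra_diff local_algebra_mult local_algebra_power
    local_algebra_generator local_algebra_numeral local_algebra_Const
  have abc_local: "a \<in> local_algebra" "b \<in> local_algebra" "c \<in> local_algebra"
    unfolding defs by (rule local_algebra_eigenvalue)+
  note interp = lagrange_interpolation[where ?'a = 'k, folded a_def b_def c_def]
  have d0: "d + e + f \<in> local_algebra"
    unfolding def using local_algebra_Const[of 0] by (simp add: ring_hom_0[OF Const_hom])
  have d1: "a * d + b * e + c * f \<in> local_algebra"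
    using local_algebra_generator[of G_xy, where ?'a = 'k] by (simp add: t slice_values_def)
  have d2: "a ^ 2 * d + b ^ 2 * e + c ^ 2 * f \<in> local_algebra"
    using local_algebra_generator[of G_xxy, where ?'a = 'k] by (simp add: t slice_values_def)
  note def_local = interp[OF d0 d1 d2]
  have "2 * (p + q + r) = ?t G_yy - (d^2 + e^2 + f^2)"
    by (simp add: t slice_values_def)
  also have "\<dots> \<in> local_algebra" by (intro closed def_local)
  finally have p0: "p + q + r \<in> local_algebra" by (rule local_algebra_cancel_numeral)
  have "a * p + b * q + c * r = a * d^2 + b * e^2 + c * f^2 - ?t G_xyy"
    using abc by (simp add: t slice_values_def) algebra
  also have "\<dots> \<in> local_algebra" by (intro closed def_local abc_local)
  finally have p1: "a * p + b * q + c * r \<in> local_algebra" .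
  \<comment> \<open>From \<open>(b - c)\<^sup>2 = 2 tr(x\<^sup>2) - 3 a\<^sup>2\<close>, which holds because the eigenvalues sum to \<open>0\<close>.\<close>
  have "3 * (a^2 * p + b^2 * q + c^2 * r) = 2 * ?t G_xx * (p + q + r) - ?t G_v"
    using abc by (simp add: t slice_values_def) algebra
  also have "\<dots> \<in> local_algebra" by (intro closed p0)
  finally have p2: "a^2 * p + b^2 * q + c^2 * r \<in> local_algebra" by (rule local_algebra_cancel_numeral)
  note pqr_local = interp[OF p0 p1 p2]
  have "3 * (s + s') = ?t G_yyy - (d^3 + e^3 + f^3 + 3 * ((e + f) * p + (d + f) * q + (d + e) * r))"
    by (simp add: t slice_values_def)
  also have "\<dots> \<in> local_algebra" by (intro closed def_local pqr_local)
  finally have sum: "s + s' \<in> local_algebra" by (rule local_algebra_cancel_numeral)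
  have "((a - b) * (b - c) * (c - a)) * (s - s') \<in> local_algebra"
    using local_algebra_generator[of G_w, where ?'a = 'k] by (simp add: t slice_values_def)
  then have diff: "s - s' \<in> local_algebra"
    by (rule local_algebra_cancel_vandermonde[where ?'a = 'k, of _ _ "(a - b) * (b - c) * (c - a)", folded a_def b_def c_def])
      ((intro closed abc_local)[1], algebra)
  have "2 * s = (s + s') + (s - s')" by simp
  also have "\<dots> \<in> local_algebra" by (intro closed sum diff)
  finally show "y_var 1 2 * y_var 2 3 * y_var 3 1 \<in> (local_algebra :: 'k Omega set)"
    unfolding s_def by (rule local_algebra_cancel_numeral)
  have "2 * s' = (s + s') - (s - s')" by simp
  also have "\<dots> \<in> local_algebra" by (intro closed sum diff)
  finally show "y_var 1 3 * y_var 3 2 * y_var 2 1 \<in> (local_algebra :: 'k Omega set)"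
    unfolding s'_def by (rule local_algebra_cancel_numeral)
  show "y_var 2 3 * y_var 3 2 \<in> (local_algebra :: 'k Omega set)" "y_var 1 3 * y_var 3 1 \<in> (local_algebra :: 'k Omega set)"
    "y_var 1 2 * y_var 2 1 \<in> (local_algebra :: 'k Omega set)"
    using pqr_local by (simp_all add: p_def q_def r_def)
  have "Var (X_entry i i) = eigenvalue i + Const (1/3) * ?t G_X"
    by (simp add: eigenvalue_def restrict_slice_G_X)
  also have "\<dots> \<in> local_algebra" by (intro closed local_algebra_eigenvalue)
  finally show "Var (X_entry i i) \<in> (local_algebra :: 'k Omega set)" .
  have "\<forall>i. y_diag i \<in> (local_algebra :: 'k Omega set)"
    unfolding forall_3 using def_local by (simp add: d_def e_def f_def)
  then have "y_diag i + Const (1/3) * ?t G_Y \<in> local_algebra" by (intro closed) blast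
  moreover have "y_var i i = y_diag i + Const (1/3) * ?t G_Y"
    by (simp add: y_diag_def restrict_slice_G_Y)
  ultimately show "y_var i i \<in> (local_algebra :: 'k Omega set)" by simp
qed

text \<open>The exponents form a closed flow on three vertices, which decomposes into cycles: the 2-cycles absorb the
smaller of the two exponents on each pair of opposite edges, and the excess \<open>k\<close> is the same on all three pairs and
runs around one of the two 3-cycles.\<close>
lemma balanced_monomial_local:
  fixes n :: "3 \<Rightarrow> 3 \<Rightarrow> nat"
  assumes n: "n 1 2 + n 1 3 = n 2 1 + n 3 1" "n 2 1 + n 2 3 = n 1 2 + n 3 2"
  shows "y_var 1 2 ^ n 1 2 * y_var 1 3 ^ n 1 3 * y_var 2 1 ^ n 2 1 * y_var 2 3 ^ n 2 3 * y_var 3 1 ^ n 3 1 * y_var 3 2 ^ n 3 2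
     \<in> (local_algebra :: 'k::field_char_0 Omega set)"
proof (cases "n 2 1 \<le> n 1 2")
  case True
  define k where "k = n 1 2 - n 2 1"
  have k: "n 1 2 = n 2 1 + k" "n 3 1 = n 1 3 + k" "n 2 3 = n 3 2 + k"
    using n True by (simp_all add: k_def)
  have "y_var 1 2 ^ n 1 2 * y_var 1 3 ^ n 1 3 * y_var 2 1 ^ n 2 1 * y_var 2 3 ^ n 2 3 * y_var 3 1 ^ n 3 1 * y_var 3 2 ^ n 3 2
    = (y_var 1 2 * y_var 2 1) ^ n 2 1 * (y_var 1 3 * y_var 3 1) ^ n 1 3 * (y_var 2 3 * y_var 3 2) ^ n 3 2
      * (y_var 1 2 * y_var 2 3 * y_var 3 1 :: 'k Omega) ^ k"
    by (simp only: k power_add power_mult_distrib mult_ac)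
  then show ?thesis
    by (simp only: local_algebra_mult local_algebra_power torus_invariants_local)
next
  case False
  define k where "k = n 2 1 - n 1 2"
  have k: "n 2 1 = n 1 2 + k" "n 1 3 = n 3 1 + k" "n 3 2 = n 2 3 + k"
    using n False by (simp_all add: k_def)
  have "y_var 1 2 ^ n 1 2 * y_var 1 3 ^ n 1 3 * y_var 2 1 ^ n 2 1 * y_var 2 3 ^ n 2 3 * y_var 3 1 ^ n 3 1 * y_var 3 2 ^ n 3 2
    = (y_var 1 2 * y_var 2 1) ^ n 1 2 * (y_var 1 3 * y_var 3 1) ^ n 3 1 * (y_var 2 3 * y_var 3 2) ^ n 2 3
      * (y_var 1 3 * y_var 3 2 * y_var 2 1 :: 'k Omega) ^ k"
    by (simp only: k power_add power_mult_distrib mult_ac)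
  then show ?thesis
    by (simp only: local_algebra_mult local_algebra_power torus_invariants_local)
qed

lemma monom_value_zero:
  assumes "Poly_Mapping.lookup m i \<noteq> 0" "f i = 0"
  shows "monom_value f m = 0"
  unfolding monom_value_def
  by (rule prod_zero) (use assms in \<open>auto simp: in_keys_iff zero_power intro!: bexI[of _ i]\<close>)

text \<open>A monomial containing an entry of \<open>X\<close> off the diagonal vanishes on the slice; for the others the entries of
\<open>Y\<close> alone are balanced, as diagonal entries have weight zero.\<close>
lemma restricted_monomial_local:
  fixes f :: "'k::field_char_0 Omega"
  assumes "f \<in> C32" "m \<in> Poly_Mapping.keys f"
  shows "monom_value (entry_value X_diag Y_mat) m \<in> (local_algebra :: 'k Omega set)"
proof (cases "X_offdiag_free m")
  case False
  then obtain i j where "i \<noteq> j" "Poly_Mapping.lookup m (X_entry i j) \<noteq> 0"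
    by (auto simp: X_offdiag_free_def)
  then have "monom_value (entry_value X_diag Y_mat) m = (0 :: 'k Omega)"
    by (intro monom_value_zero[of m "X_entry i j"]) (simp_all add: X_diag_nth)
  then show ?thesis using local_algebra_Const[of 0] by (simp add: ring_hom_0[OF Const_hom])
next
  case True
  let ?l = "Poly_Mapping.lookup m"
  have offdiag: "?l (X_entry 1 2) = 0" "?l (X_entry 1 3) = 0" "?l (X_entry 2 1) = 0"
    "?l (X_entry 2 3) = 0" "?l (X_entry 3 1) = 0" "?l (X_entry 3 2) = 0"
    using True by (simp_all add: X_offdiag_free_def)
  have Y: "Y_mat $ i $ j = y_var i j" for i j by (simp add: Y_mat_def)
  have X: "X_diag $ i $ i = Var (X_entry i i)" for i by (simp add: X_diag_nth)
  note balanced = balanced_monomial_local[of "\<lambda>i j. ?l (Y_entry i j)", OF torus_weights(1,2)[OF assms True]]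
  have "monom_value (entry_value X_diag Y_mat) m =
      Var (X_entry 1 1) ^ ?l (X_entry 1 1) * Var (X_entry 2 2) ^ ?l (X_entry 2 2)
      * Var (X_entry 3 3) ^ ?l (X_entry 3 3)
      * (y_var 1 1 ^ ?l (Y_entry 1 1) * y_var 2 2 ^ ?l (Y_entry 2 2) * y_var 3 3 ^ ?l (Y_entry 3 3))
      * (y_var 1 2 ^ ?l (Y_entry 1 2) * y_var 1 3 ^ ?l (Y_entry 1 3) * y_var 2 1 ^ ?l (Y_entry 2 1)
         * y_var 2 3 ^ ?l (Y_entry 2 3) * y_var 3 1 ^ ?l (Y_entry 3 1) * y_var 3 2 ^ ?l (Y_entry 3 2) :: 'k Omega)"
    unfolding monom_value_entry prod_3 entry_value_simps
    by (simp only: X Y offdiag power_0 mult_1_left mult_1_right mult_ac)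
  moreover have "\<dots> \<in> local_algebra"
    by (rule local_algebra_mult[OF _ balanced])
      (intro local_algebra_mult local_algebra_power torus_invariants_local)
  ultimately show ?thesis by (simp only:)
qed

lemma restrict_slice_local:
  fixes f :: "'k::field_char_0 Omega"
  assumes "f \<in> C32"
  shows "restrict_slice f \<in> local_algebra"
  unfolding restrict_slice_def alg_hom_eq_eval eval_mpoly_def
  by (intro local_algebra_sum local_algebra_mult local_algebra_Const restricted_monomial_local[OF assms])

section \<open>Averaging over the permutations of the eigenvalues\<close>

text \<open>Conjugation by the permutation matrix of an involution \<open>\<sigma>\<close>.\<close>
definition permute :: "(3 \<Rightarrow> 3) \<Rightarrow> 'k::field_char_0 Omega \<Rightarrow> 'k Omega" where
  "permute \<sigma> = alg_hom (entry_value (\<chi> i j. Var (X_entry (\<sigma> i) (\<sigma> j))) (\<chi> i j. Var (Y_entry (\<sigma> i) (\<sigma> j))))"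

lemma permute_hom: "is_ring_hom (permute \<sigma>)"
  by (simp add: permute_def alg_hom_hom)

lemmas permute_simps = ring_hom_simps[OF permute_hom]

lemma permute_C32:
  fixes f :: "'k::field_char_0 Omega"
  assumes f: "f \<in> C32" and \<sigma>: "\<And>i. \<sigma> (\<sigma> i) = i"
  shows "permute \<sigma> f = f"
proof -
  let ?P = "(\<chi> i j. if j = \<sigma> i then 1 else 0) :: 'k^3^3"
  have inv: "j = \<sigma> i \<longleftrightarrow> i = \<sigma> j" for i j using \<sigma> by metis
  have P: "?P ** ?P = mat 1"
    by (simp add: vec_eq_iff matrix_matrix_mult_def mat_def \<sigma> if_distrib[of "\<lambda>x. x * _"] cong: if_cong)
  have CP: "const_matrix ?P = (\<chi> i j. if j = \<sigma> i then 1 else 0)"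
    by (simp add: const_matrix_def vec_eq_iff ring_hom_0[OF Const_hom] ring_hom_1[OF Const_hom])
  have "const_matrix ?P ** Z = (\<chi> i j. Z $ \<sigma> i $ j)" for Z :: "'k Omega^3^3"
    unfolding CP by (simp add: vec_eq_iff matrix_matrix_mult_def if_distrib[of "\<lambda>x. x * _"] cong: if_cong)
  moreover have "Z ** const_matrix ?P = (\<chi> i j. Z $ i $ \<sigma> j)" for Z :: "'k Omega^3^3"
    unfolding CP by (subst inv)
      (simp add: vec_eq_iff matrix_matrix_mult_def if_distrib[of "\<lambda>x. _ * x"] cong: if_cong)
  ultimately have "const_matrix ?P ** Z ** const_matrix ?P = (\<chi> i j. Z $ \<sigma> i $ \<sigma> j)" for Z
    by (simp add: vec_eq_iff)
  with C32_conjugation[OF f P P] show ?thesis by (simp add: permute_def X_mat_def Y_mat_def)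
qed

lemma permute_restrict_slice:
  fixes f :: "'k::field_char_0 Omega"
  assumes "\<And>i. \<sigma> (\<sigma> i) = i"
  shows "permute \<sigma> (restrict_slice f) = restrict_slice (permute \<sigma> f)"
proof -
  have "\<sigma> i = \<sigma> j \<longleftrightarrow> i = j" for i j using assms by metis
  then have "permute \<sigma> (entry_value X_diag Y_mat e :: 'k Omega) = restrict_slice (permute \<sigma> (Var e))" for e
    by (cases e) (simp_all add: permute_def restrict_slice_def X_diag_nth Y_mat_def ring_hom_0[OF alg_hom_hom])
  then show ?thesis
    unfolding restrict_slice_def permute_def alg_hom_alg_hom by (simp only: alg_hom_Var)
qed

definition transpositions :: "(3 \<Rightarrow> 3) set" where
  "transpositions = {triple 2 1 3, triple 3 2 1, triple 1 3 2}"

lemma transposition_involution: "\<sigma> \<in> transpositions \<Longrightarrow> \<sigma> (\<sigma> i) = i"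
proof -
  assume "\<sigma> \<in> transpositions"
  then have "\<forall>i. \<sigma> (\<sigma> i) = i" by (auto simp: transpositions_def forall_3)
  then show ?thesis by blast
qed

lemma permute_restricted_invariant:
  "\<sigma> \<in> transpositions \<Longrightarrow> f \<in> C32 \<Longrightarrow> permute \<sigma> (restrict_slice f) = restrict_slice f"
  by (simp add: permute_restrict_slice permute_C32 transposition_involution)

lemma permute_slice_algebra:
  fixes f :: "'k::field_char_0 Omega"
  assumes "\<sigma> \<in> transpositions" "f \<in> slice_algebra"
  shows "permute \<sigma> f = f"
proof -
  obtain P where "f = restrict_slice (alg_hom generator P)"
    using assms(2) by (auto simp: slice_algebra_def)
  then show ?thesis
    using permute_restricted_invariant[OF assms(1) trace_algebra_subset_C32[of P]] by simp
qed

lemma permute_eigenvalue: "\<sigma> \<in> transpositions \<Longrightarrow> permute \<sigma> (eigenvalue i) = eigenvalue (\<sigma> i)"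
  unfolding eigenvalue_def permute_simps
  by (auto simp: transpositions_def permute_def ac_simps)

text \<open>The sum over the symmetric group, factored as \<open>(1 + (1 2)) (1 + (1 3) + (2 3))\<close>: each of the six permutations
arises once, and only transpositions, which are involutions, are needed.\<close>
definition symmetrize :: "'k::field_char_0 Omega \<Rightarrow> 'k Omega" where
  "symmetrize f = (let g = f + permute (triple 3 2 1) f + permute (triple 1 3 2) f
     in g + permute (triple 2 1 3) g)"

lemma symmetrize_add: "symmetrize (f + g) = symmetrize f + symmetrize g"
  by (simp add: symmetrize_def Let_def permute_simps)

lemma symmetrize_scale:
  assumes "c \<in> slice_algebra"
  shows "symmetrize (c * f) = c * symmetrize f"
proof -
  have "permute \<sigma> c = c" if "\<sigma> \<in> transpositions" for \<sigma>
    using that assms by (rule permute_slice_algebra)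
  then show ?thesis
    by (simp add: symmetrize_def Let_def permute_simps transpositions_def distrib_left)
qed

lemma symmetrize_invariant:
  assumes "\<And>\<sigma>. \<sigma> \<in> transpositions \<Longrightarrow> permute \<sigma> f = f"
  shows "symmetrize f = 6 * f"
proof -
  have "permute (triple 2 1 3) f = f" "permute (triple 3 2 1) f = f" "permute (triple 1 3 2) f = f"
    by (rule assms, simp add: transpositions_def)+
  then show ?thesis by (simp add: symmetrize_def Let_def permute_simps)
qed

definition power_sum :: "nat \<Rightarrow> 'k::field_char_0 Omega" where
  "power_sum n = eigenvalue 1 ^ n + eigenvalue 2 ^ n + eigenvalue 3 ^ n"

text \<open>Newton's recursion for the traceless cubic:
\<open>p\<^sub>k\<^sub>+\<^sub>3 = tr(x\<^sup>2)/2 p\<^sub>k\<^sub>+\<^sub>1 + tr(x\<^sup>3)/3 p\<^sub>k\<close>.\<close>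
lemma power_sum_in: "power_sum n \<in> slice_algebra"
proof (induction n rule: less_induct)
  case (less n)
  note closed = slice_algebra_add slice_algebra_mult slice_algebra_Const slice_algebra_generator
  consider "n = 0" | "n = 1" | "n = 2" | k where "n = k + 3"
    by (metis One_nat_def Suc_1 add.commute le_Suc_ex less_2_cases not_less numeral_3_eq_3 not_less_eq_eq le_antisym)
  then show ?case
  proof cases
    case 1
    have "power_sum 0 = 3" by (simp add: power_sum_def)
    then show ?thesis using 1 slice_algebra_numeral by metis
  next
    case 2
    then show ?thesis using slice_algebra_Const[of 0] by (simp add: power_sum_def eigenvalue_sum ring_hom_0[OF Const_hom])
  next
    case 3
    then show ?thesis using slice_algebra_generator[of G_xx]
      by (simp add: power_sum_def restrict_slice_generator slice_values_def)
  next
    case (4 k)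
    define a :: "'a Omega" where "a = eigenvalue 1"
    define b :: "'a Omega" where "b = eigenvalue 2"
    have c: "eigenvalue 3 = - a - b" using eigenvalue_sum[where ?'a = 'a] unfolding a_def b_def by algebra
    have "6 * power_sum n = 3 * restrict_slice (generator G_xx) * power_sum (k + 1)
        + 2 * (restrict_slice (generator G_xxx) :: 'a Omega) * power_sum k"
      unfolding 4 power_sum_def
      by (simp add: restrict_slice_generator slice_values_def c power_add power2_eq_square
          power3_eq_cube flip: a_def b_def) algebra
    also have "\<dots> \<in> slice_algebra"
      by (intro closed slice_algebra_numeral less) (simp_all add: 4)
    finally have "Const (1/6) * (6 * power_sum n) \<in> (slice_algebra :: 'a Omega set)"
      by (rule slice_algebra_mult[OF slice_algebra_Const])
    then show ?thesis by (simp only: Const_inverse_times_numeral)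
  qed
qed

text \<open>The sum over all triples of indices is a product of three power sums; inclusion and exclusion remove the
triples with repeated indices.\<close>
lemma symmetrize_monomial: "symmetrize (eigenvalue 1 ^ i * eigenvalue 2 ^ j * eigenvalue 3 ^ k) \<in> slice_algebra"
proof -
  have "symmetrize (eigenvalue 1 ^ i * eigenvalue 2 ^ j * eigenvalue 3 ^ k) =
     power_sum i * power_sum j * power_sum k - power_sum (i + j) * power_sum k
     - power_sum (i + k) * power_sum j - power_sum (j + k) * power_sum i + 2 * power_sum (i + j + k)"
    by (simp add: symmetrize_def Let_def permute_simps permute_eigenvalue transpositions_def power_sum_def power_add)
      algebra
  also have "\<dots> \<in> slice_algebra"
    by (intro slice_algebra_add slice_algebra_diff slice_algebra_mult power_sum_in slice_algebra_numeral)
  finally show ?thesis .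
qed

text \<open>Elements of \<open>slice_algebra\<close> are symmetric and pass through the average, so only monomials in the eigenvalues
remain to be averaged.  The extra monomial factor makes the statement inductive.\<close>
lemma symmetrize_eigenvalue_algebra:
  assumes "f \<in> eigenvalue_algebra"
  shows "symmetrize f \<in> slice_algebra"
proof -
  have "symmetrize (f * (eigenvalue 1 ^ i * eigenvalue 2 ^ j * eigenvalue 3 ^ k)) \<in> slice_algebra" for i j k
    using assms
  proof (induction arbitrary: i j k)
    case (base f)
    then show ?case by (simp only: symmetrize_scale slice_algebra_mult symmetrize_monomial)
  next
    case (add f g)
    then show ?case by (simp only: distrib_right symmetrize_add slice_algebra_add)
  next
    case (eigenvalue f l)
    have "\<forall>l. symmetrize (eigenvalue l * f * (eigenvalue 1 ^ i * eigenvalue 2 ^ j * eigenvalue 3 ^ k)) \<in> slice_algebra"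
      unfolding forall_3 using eigenvalue.IH[of "Suc i" j k] eigenvalue.IH[of i "Suc j" k] eigenvalue.IH[of i j "Suc k"]
      by (simp add: mult_ac)
    then show ?case by blast
  qed
  from this[of 0 0 0] show ?thesis by simp
qed

text \<open>A power of the discriminant times \<open>f\<close> restricts to an element of the eigenvalue algebra.  Since this
restriction is symmetric, it is one sixth of its symmetrization and so the restriction of some \<open>h\<close> in \<open>A\<close>.  Invariants are
determined by their restrictions.\<close>
lemma x_disc_power_in_trace_algebra:
  fixes f :: "'k::field_char_0 Omega"
  assumes f: "f \<in> C32"
  shows "\<exists>n. x_disc generator ^ n * f \<in> trace_algebra"
proof -
  obtain n where n: "slice_disc ^ n * restrict_slice f \<in> eigenvalue_algebra"
    using restrict_slice_local[OF f] by (auto simp: local_algebra_def)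
  let ?g = "slice_disc ^ n * restrict_slice f"
  have d: "restrict_slice (x_disc generator) = slice_disc"
    unfolding slice_disc_def x_disc_def ring_hom_simps[OF restrict_slice_hom]
    by (simp add: restrict_slice_def)
  have "permute \<sigma> ?g = ?g" if "\<sigma> \<in> transpositions" for \<sigma>
    using permute_slice_algebra[OF that slice_disc_in[where ?'a = 'k]] permute_restricted_invariant[OF that f]
    by (simp add: permute_simps)
  then have "symmetrize ?g = 6 * ?g" by (rule symmetrize_invariant)
  moreover have "symmetrize ?g \<in> slice_algebra" using n by (rule symmetrize_eigenvalue_algebra)
  ultimately obtain h where h: "h \<in> trace_algebra" "6 * ?g = restrict_slice h"
    by (auto simp: slice_algebra_def)
  let ?F = "6 * (x_disc generator ^ n * f) - h"
  have "restrict_slice ?F = 0"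
    unfolding ring_hom_simps[OF restrict_slice_hom] d h(2) by simp
  moreover have "?F \<in> C32"
  proof -
    have "h \<in> C32" using h(1) trace_algebra_subset_C32 by blast
    moreover have "(6 :: 'k Omega) \<in> C32" using C32_Const[of 6] by (simp add: Const_numeral)
    moreover have "x_disc generator \<in> (C32 :: 'k Omega set)"
      unfolding x_disc_def by (intro C32_diff C32_mult C32_power C32_Const generator_in_C32)
    ultimately show ?thesis by (intro C32_diff C32_mult C32_power f)
  qed
  ultimately have "?F = 0" by (rule restrict_slice_injective[rotated])
  then have 6: "6 * (x_disc generator ^ n * f) = h" by simp
  have "Const (1/6) * (6 * (x_disc generator ^ n * f)) = x_disc generator ^ n * f"
    by (rule Const_inverse_times_numeral)
  then have "x_disc generator ^ n * f = Const (1/6) * h" unfolding 6 by (rule sym)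
  also have "\<dots> \<in> trace_algebra" by (rule trace_algebra_mult[OF trace_algebra_Const h(1)])
  finally show ?thesis by (rule exI)
qed

section \<open>Exchanging the two matrices\<close>

definition y_disc :: "(gen \<Rightarrow> ('x, 'k::field_char_0) mpoly) \<Rightarrow> ('x, 'k) mpoly" where
  "y_disc t = t G_yyy ^ 2 - Const (1/6) * t G_yy ^ 3"

definition swap_XY :: "'k::field_char_0 Omega \<Rightarrow> 'k Omega" where
  "swap_XY = alg_hom (entry_value Y_mat X_mat)"

lemma swap_XY_hom: "is_ring_hom swap_XY"
  by (simp add: swap_XY_def alg_hom_hom)

lemma swap_XY_swap_XY: "swap_XY (swap_XY f) = (f :: 'k::field_char_0 Omega)"
proof -
  have "alg_hom (entry_value Y_mat X_mat) (entry_value Y_mat X_mat e) = (Var e :: 'k Omega)" for e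
    by (cases e) (simp_all add: X_mat_def Y_mat_def)
  then show ?thesis by (simp add: swap_XY_def alg_hom_alg_hom alg_hom_Var_id)
qed

lemma eval_at_swap_XY: "eval_at (entry_value X Y) (swap_XY f) = eval_at (entry_value Y X) f"
proof -
  have "eval_at (entry_value X Y) (entry_value Y_mat X_mat e) = entry_value Y X e" for e
    by (cases e) (simp_all add: X_mat_def Y_mat_def id_hom)
  then show ?thesis by (simp add: swap_XY_def eval_at_alg_hom)
qed

lemma swap_XY_C32:
  fixes f :: "'k::field_char_0 Omega"
  assumes "f \<in> C32"
  shows "swap_XY f \<in> C32"
proof -
  have "GL3_act g (swap_XY f) = swap_XY f" if "invertible g" for g :: "'k^3^3"
  proof (rule mpoly_eqI)
    fix z :: "entry \<Rightarrow> 'k"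
    have z: "z = entry_value (\<chi> p q. z (X_entry p q)) (\<chi> p q. z (Y_entry p q))"
      by (rule entry_value_surj[symmetric])
    have "GL3_act g f = f" using assms that by (simp add: C32_def)
    then show "eval_at z (GL3_act g (swap_XY f)) = eval_at z (swap_XY f)"
      by (subst (1 2) z) (simp only: eval_at_GL3_act eval_at_swap_XY flip: eval_at_GL3_act[of _ _ g f])
  qed
  then show ?thesis by (simp add: C32_def)
qed

lemma generator_value_swap:
  "generator_value \<theta> Y X G = (case G of G_X \<Rightarrow> generator_value \<theta> X Y G_Y | G_Y \<Rightarrow> generator_value \<theta> X Y G_X
     | G_xx \<Rightarrow> generator_value \<theta> X Y G_yy | G_xy \<Rightarrow> generator_value \<theta> X Y G_xy | G_yy \<Rightarrow> generator_value \<theta> X Y G_xx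
     | G_xxx \<Rightarrow> generator_value \<theta> X Y G_yyy | G_xxy \<Rightarrow> generator_value \<theta> X Y G_xyy | G_xyy \<Rightarrow> generator_value \<theta> X Y G_xxy
     | G_yyy \<Rightarrow> generator_value \<theta> X Y G_xxx | G_v \<Rightarrow> generator_value \<theta> X Y G_v | G_w \<Rightarrow> - generator_value \<theta> X Y G_w)"
proof -
  define x where "x = traceless_by \<theta> X"
  define y where "y = traceless_by \<theta> Y"
  have cyc: "trace (y ** x) = trace (x ** y)" "trace (y ** y ** x) = trace (x ** y ** y)"
    "trace (y ** x ** x) = trace (x ** x ** y)"
    "trace (y ** y ** x ** x) = trace (x ** x ** y ** y)"
    "trace (y ** x ** y ** x) = trace (x ** y ** x ** y)"
    using trace_mul_sym[of y x] trace_mul_sym[of "y ** y" x] trace_mul_sym[of y "x ** x"]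
      trace_mul_sym[of "y ** y" "x ** x"] trace_mul_sym[of y "x ** y ** x"]
    by (simp_all add: matrix_mul_assoc)
  show ?thesis
    by (cases G) (simp_all add: Let_def cyc flip: x_def y_def)
qed

lemma swap_XY_generator:
  "swap_XY (generator G) = generator_value (Const (1/3)) Y_mat X_mat G"
  by (simp add: swap_XY_def alg_hom_generator)

lemma swap_XY_trace_algebra:
  fixes f :: "'k::field_char_0 Omega"
  assumes "f \<in> trace_algebra"
  shows "swap_XY f \<in> trace_algebra"
proof -
  have "swap_XY (alg_hom generator P) \<in> (trace_algebra :: 'k Omega set)" for P
  proof (induction P rule: mpoly_induct)
    case (Const c)
    then show ?case using trace_algebra_Const[of c] by (simp add: swap_XY_def)
  next
    case (Var G)
    have neg: "- generator G_w \<in> (trace_algebra :: 'k Omega set)"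
    proof -
      have "- generator G_w = ( Const (-1) * generator G_w :: 'k Omega)"
        by (simp add: ring_hom_uminus[OF Const_hom] ring_hom_1[OF Const_hom])
      then show ?thesis by (simp only: trace_algebra_mult trace_algebra_Const trace_algebra_generator)
    qed
    show ?case
      unfolding alg_hom_Var swap_XY_generator
      by (subst generator_value_swap, cases G)
        (simp_all only: gen.case neg trace_algebra_generator flip: generator_eq_generator_value)
  next
    case (add p q)
    then show ?case by (simp only: ring_hom_add[OF alg_hom_hom] ring_hom_add[OF swap_XY_hom] trace_algebra_add)
  next
    case (mult p q)
    then show ?case by (simp only: ring_hom_mult[OF alg_hom_hom] ring_hom_mult[OF swap_XY_hom] trace_algebra_mult)
  qed
  then show ?thesis using assms by blast
qed

lemma y_disc_power_in_trace_algebra: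
  fixes f :: "'k::field_char_0 Omega"
  assumes f: "f \<in> C32"
  shows "\<exists>n. y_disc generator ^ n * f \<in> trace_algebra"
proof -
  obtain n where n: "x_disc generator ^ n * swap_XY f \<in> trace_algebra"
    using x_disc_power_in_trace_algebra[OF swap_XY_C32[OF f]] by blast
  have "swap_XY (generator G_xxx) = (generator G_yyy :: 'k Omega)"
       "swap_XY (generator G_xx) = (generator G_yy :: 'k Omega)"
    by (simp_all only: swap_XY_generator generator_value_swap[of _ Y_mat X_mat] gen.case flip: generator_eq_generator_value)
  then have "swap_XY (x_disc generator) = (y_disc generator :: 'k Omega)"
    unfolding x_disc_def y_disc_def ring_hom_simps[OF swap_XY_hom] by (simp add: swap_XY_def)
  with swap_XY_trace_algebra[OF n] have "y_disc generator ^ n * f \<in> trace_algebra"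
    by (simp add: ring_hom_simps[OF swap_XY_hom] swap_XY_swap_XY)
  then show ?thesis by (rule exI)
qed

section \<open>Transposition\<close>

lemma trace_transpose: "trace (transpose A) = trace A"
  by (simp add: trace_def transpose_def)

text \<open>Transposition reverses words, and the trace of a reversed word is a cyclic rotation of the original one for all
the words involved except the two in \<open>w\<close>, which are interchanged.\<close>
lemma generator_value_transpose:
  fixes X Y :: "'a::comm_ring_1^3^3"
  shows "generator_value \<theta> (transpose X) (transpose Y) G = (if G = G_w then - generator_value \<theta> X Y G else generator_value \<theta> X Y G)"
proof -
  define x where "x = traceless_by \<theta> X"
  define y where "y = traceless_by \<theta> Y"
  have t: "traceless_by \<theta> (transpose X) = transpose x" "traceless_by \<theta> (transpose Y) = transpose y"
    unfolding x_def y_def traceless_by_def trace_transpose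
    by (simp_all add: vec_eq_iff transpose_def mat_def eq_commute)
  note cyc = trace_mul_sym[of y x] trace_mul_sym[of y "x ** x"] trace_mul_sym[of "y ** y" x]
      trace_mul_sym[of "y ** y" "x ** x"] trace_mul_sym[of y "x ** y ** x"]
      trace_mul_sym[of "y ** x" "y ** y ** x ** x"] trace_mul_sym[of "x ** y" "x ** x ** y ** y"]
  show ?thesis
    by (cases G)
      (use cyc in \<open>simp_all add: Let_def t trace_transpose matrix_mul_assoc
        flip: matrix_transpose_mul x_def y_def\<close>)
qed

definition transpose_XY :: "'k::field_char_0 Omega \<Rightarrow> 'k Omega" where
  "transpose_XY = alg_hom (entry_value (transpose X_mat) (transpose Y_mat))"

lemma transpose_XY_hom: "is_ring_hom transpose_XY"
  by (simp add: transpose_XY_def alg_hom_hom)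

lemma transpose_XY_generator:
  "transpose_XY (generator G) = (if G = G_w then - generator G else generator G)"
  unfolding transpose_XY_def alg_hom_generator generator_value_transpose by (simp only: generator_eq_generator_value)

lemma generator_G_w_nonzero: "generator G_w \<noteq> (0 :: 'k::field_char_0 Omega)"
proof
  assume 0: "generator G_w = (0 :: 'k Omega)"
  let ?X = "diag3 1 0 (-1) :: 'k^3^3" and ?Y = "matrix3 0 1 0 0 0 1 1 0 0"
  have "eval_at (entry_value ?X ?Y) (generator G_w) = -2"
    unfolding eval_at_generator by (subst generator_value_on_slice) (simp_all add: slice_values_def)
  then show False by (simp add: 0 ring_hom_0[OF eval_mpoly_hom[OF id_hom]])
qed

section \<open>Normal form modulo the relation\<close>

text \<open>The polynomials in the first ten variables, characterised as the fixed points of the substitution of \<open>0\<close> for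
\<open>G_w\<close>.\<close>
definition w_free :: "(gen, 'k::field_char_0) mpoly \<Rightarrow> bool" where
  "w_free P \<longleftrightarrow> alg_hom (\<lambda>G. if G = G_w then 0 else Var G) P = P"

lemma w_free_uminus: "w_free P \<Longrightarrow> w_free (- P)"
  by (simp add: w_free_def ring_hom_uminus[OF alg_hom_hom])

lemma w_free_simps: "w_free (Const c)" "G \<noteq> G_w \<Longrightarrow> w_free (Var G)"
  "w_free P \<Longrightarrow> w_free Q \<Longrightarrow> w_free (P + Q)" "w_free P \<Longrightarrow> w_free Q \<Longrightarrow> w_free (P - Q)"
  "w_free P \<Longrightarrow> w_free Q \<Longrightarrow> w_free (P * Q)" "w_free P \<Longrightarrow> w_free (P ^ n)"
  by (simp_all add: w_free_def ring_hom_simps[OF alg_hom_hom])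

lemma w_free_0: "w_free 0" and w_free_1: "w_free 1"
  by (simp_all add: w_free_def ring_hom_simps[OF alg_hom_hom])

lemma w_free_numeral: "w_free (numeral k)"
  by (simp add: w_free_def ring_hom_simps[OF alg_hom_hom])

lemma w_free_alg_hom_cong:
  assumes "w_free P" "\<And>G. G \<noteq> G_w \<Longrightarrow> f G = g G"
  shows "alg_hom f P = alg_hom g P"
proof -
  let ?k = "\<lambda>G. if G = G_w then 0 else Var G"
  have "alg_hom f (?k G) = alg_hom g (?k G)" for G
    using assms(2) by (simp add: ring_hom_0[OF alg_hom_hom])
  then have "alg_hom f (alg_hom ?k P) = alg_hom g (alg_hom ?k P)"
    by (simp only: alg_hom_alg_hom)
  then show ?thesis using assms(1) by (simp add: w_free_def)
qed

lemma w_free_eval_cong: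
  assumes "w_free P" "\<And>G. G \<noteq> G_w \<Longrightarrow> f G = g G"
  shows "eval_at f P = eval_at g P"
proof -
  let ?k = "\<lambda>G. if G = G_w then 0 else Var G"
  have "eval_at f (?k G) = eval_at g (?k G)" for G
    using assms(2) by (simp add: ring_hom_0[OF eval_mpoly_hom[OF id_hom]] id_hom)
  then have "eval_at f (alg_hom ?k P) = eval_at g (alg_hom ?k P)"
    by (simp only: eval_at_alg_hom)
  then show ?thesis using assms(1) by (simp add: w_free_def)
qed

lemma G_w_square: "\<exists>c. w_free c \<and> Var G_w ^ 2 = (relation :: (gen, 'k::field_char_0) mpoly) + c"
proof -
  define c :: "(gen, 'k) mpoly" where "c = Var G_w ^ 2 - relation"
  have "w_free c"
    unfolding c_def relation_def w1_def w2_def w3'_def w3''_def w4_def w5_def w6_def w7_def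
      det_u_def det_D_def det22_def det_2 det_3
    by (simp add: w_free_simps w_free_numeral w_free_uminus)
  moreover have "Var G_w ^ 2 = relation + c" by (simp add: c_def)
  ultimately show ?thesis by blast
qed

text \<open>Polynomials of this form are closed under products because \<open>G_w\<^sup>2\<close> is a polynomial in the other variables
modulo the relation.\<close>
lemma normal_form:
  "\<exists>Q a b. w_free a \<and> w_free b \<and> P = relation * Q + a + b * (Var G_w :: (gen, 'k::field_char_0) mpoly)"
proof (induction P rule: mpoly_induct)
  case (Const c)
  have "Const c = relation * 0 + Const c + 0 * (Var G_w :: (gen, 'k) mpoly)" by simp
  then show ?case using w_free_simps(1) w_free_0 by blast
next
  case (Var G)
  show ?case
  proof (cases "G = G_w")
    case True
    have "Var G = relation * 0 + 0 + 1 * (Var G_w :: (gen, 'k) mpoly)" using True by simp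
    then show ?thesis using w_free_1 w_free_0 by blast
  next
    case False
    have "Var G = relation * 0 + Var G + 0 * (Var G_w :: (gen, 'k) mpoly)" by simp
    then show ?thesis using w_free_simps(2)[OF False] w_free_0 by blast
  qed
next
  case (add P P')
  then obtain Q a b Q' a' b' where *: "w_free a" "w_free b" "P = relation * Q + a + b * Var G_w"
    "w_free a'" "w_free b'" "P' = relation * Q' + a' + b' * Var G_w" by blast
  have "P + P' = relation * (Q + Q') + (a + a') + (b + b') * Var G_w"
    unfolding * by (simp add: algebra_simps)
  then show ?case using * w_free_simps(3) by blast
next
  case (mult P P')
  then obtain Q a b Q' a' b' where *: "w_free a" "w_free b" "P = relation * Q + a + b * Var G_w"
    "w_free a'" "w_free b'" "P' = relation * Q' + a' + b' * Var G_w" by blast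
  obtain c :: "(gen, 'k) mpoly" where c: "w_free c" "Var G_w ^ 2 = relation + c"
    using G_w_square by blast
  have "P * P' = relation * (Q * P' + (a + b * Var G_w) * Q' + b * b')
      + (a * a' + b * b' * c) + (a * b' + a' * b) * Var G_w"
    unfolding *(3,6) using c(2) by algebra
  moreover have "w_free (a * a' + b * b' * c)" "w_free (a * b' + a' * b)"
    using * c by (simp_all add: w_free_simps)
  ultimately show ?case by blast
qed

section \<open>Algebraic independence of ten generators\<close>

lemma moments_solvable:
  fixes a b c :: "'k::field_char_0"
  assumes "a \<noteq> b" "a \<noteq> c" "b \<noteq> c"
  shows "\<exists>u1 u2 u3. u1 + u2 + u3 = T0 \<and> a * u1 + b * u2 + c * u3 = T1
    \<and> a^2 * u1 + b^2 * u2 + c^2 * u3 = T2"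
proof -
  define u1 where "u1 = (T2 - (b + c) * T1 + b * c * T0) / ((a - b) * (a - c))"
  define u2 where "u2 = - (T2 - (a + c) * T1 + a * c * T0) / ((a - b) * (b - c))"
  define u3 where "u3 = (T2 - (a + b) * T1 + a * b * T0) / ((a - c) * (b - c))"
  have u: "u1 * ((a - b) * (a - c)) = T2 - (b + c) * T1 + b * c * T0"
    "u2 * ((a - b) * (b - c)) = - (T2 - (a + c) * T1 + a * c * T0)"
    "u3 * ((a - c) * (b - c)) = T2 - (a + b) * T1 + a * b * T0"
    unfolding u1_def u2_def u3_def using assms by simp_all
  have V: "(a - b) * (a - c) * (b - c) \<noteq> 0" using assms by simp
  have "(a - b) * (a - c) * (b - c) * (u1 + u2 + u3) = (a - b) * (a - c) * (b - c) * T0"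
    "(a - b) * (a - c) * (b - c) * (a * u1 + b * u2 + c * u3) = (a - b) * (a - c) * (b - c) * T1"
    "(a - b) * (a - c) * (b - c) * (a^2 * u1 + b^2 * u2 + c^2 * u3) = (a - b) * (a - c) * (b - c) * T2"
    using u by algebra+
  then show ?thesis using V by (metis mult_left_cancel)
qed

text \<open>Each value is taken at most twice, as \<open>z\<close> is a root of a quadratic polynomial determined by the value.\<close>
lemma infinite_hyperbola_values:
  fixes \<kappa> h :: "'k::field_char_0"
  shows "infinite ((\<lambda>z. \<kappa> + 3 * (z + h / z)) ` (- {0}))" (is "infinite (?f ` _)")
proof
  assume fin: "finite (?f ` (- {0}))"
  have "finite {z. poly [:3 * h, \<kappa> - t, 3:] z = 0}" for t
    by (rule poly_roots_finite) simp
  then have "finite (\<Union>t\<in>?f ` (- {0}). {z. poly [:3 * h, \<kappa> - t, 3:] z = 0})" using fin by blast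
  moreover have "- {0} \<subseteq> (\<Union>t\<in>?f ` (- {0}). {z. poly [:3 * h, \<kappa> - t, 3:] z = 0})"
  proof
    fix z :: 'k assume "z \<in> - {0}"
    moreover from this have "poly [:3 * h, \<kappa> - ?f z, 3:] z = 0" by (simp add: field_simps)
    ultimately show "z \<in> (\<Union>t\<in>?f ` (- {0}). {z. poly [:3 * h, \<kappa> - t, 3:] z = 0})" by blast
  qed
  ultimately have "finite (- {0 :: 'k})" by (rule finite_subset[rotated])
  then have "finite (UNIV :: 'k set)" using finite_compl[of "{0 :: 'k}"] by simp
  then show False by (simp add: infinite_UNIV_char_0)
qed

text \<open>Fix a diagonal \<open>X\<close> with distinct entries.  The diagonal of \<open>Y\<close> and the products \<open>p, q, r\<close> can be chosen so that
all generators except \<open>tr(y\<^sup>3)\<close> and \<open>w\<close> take prescribed values.  One parameter \<open>s\<close> is left, and \<open>tr(y\<^sup>3)\<close> takes infinitely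
many values as it varies, so \<open>P\<close>, which does not contain \<open>G_w\<close>, vanishes for every value of \<open>tr(y\<^sup>3)\<close>.\<close>
lemma vanishes_on_generator_values:
  fixes P :: "(gen, 'k::field_char_0) mpoly" and z :: "gen \<Rightarrow> 'k"
  assumes P: "w_free P" "alg_hom generator P = 0"
    and distinct: "x1 \<noteq> x2" "x1 \<noteq> x3" "x2 \<noteq> x3"
  defines "m \<equiv> 1/3 * (x1 + x2 + x3)"
  assumes z: "z G_X = x1 + x2 + x3" "z G_xx = (x1 - m)^2 + (x2 - m)^2 + (x3 - m)^2"
    "z G_xxx = (x1 - m)^3 + (x2 - m)^3 + (x3 - m)^3"
  shows "eval_at z P = 0"
proof -
  let ?a = "x1 - m" and ?b = "x2 - m" and ?c = "x3 - m"
  have ne: "?a \<noteq> ?b" "?a \<noteq> ?c" "?b \<noteq> ?c" using distinct by simp_all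
  have abc: "?a + ?b + ?c = 0" by (simp add: m_def field_simps)
  obtain d e f where d: "d + e + f = 0" "?a * d + ?b * e + ?c * f = z G_xy"
    "?a^2 * d + ?b^2 * e + ?c^2 * f = z G_xxy"
    using moments_solvable[OF ne] by blast
  obtain p q r where p: "p + q + r = (z G_yy - (d^2 + e^2 + f^2)) / 2"
    "?a * p + ?b * q + ?c * r = ?a * d^2 + ?b * e^2 + ?c * f^2 - z G_xyy"
    "?a^2 * p + ?b^2 * q + ?c^2 * r = (z G_xx * (z G_yy - (d^2 + e^2 + f^2)) - z G_v) / 3"
    using moments_solvable[OF ne] by blast
  let ?n = "z G_Y / 3"
  define \<kappa> where "\<kappa> = d^3 + e^3 + f^3 + 3 * ((e + f) * p + (d + f) * q + (d + e) * r)"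
  let ?q = "\<lambda>G. if G = G_yyy then [:0, 1:] else [:z G:]"
  have ev: "(\<lambda>G. poly (?q G) t) = z(G_yyy := t)" for t by (auto simp: fun_eq_iff)
  have "(\<lambda>s. \<kappa> + 3 * (s + p * q * r / s)) ` (- {0}) \<subseteq> {t. eval_at (\<lambda>G. poly (?q G) t) P = 0}"
  proof clarify
    fix s :: 'k assume s: "s \<noteq> 0"
    let ?t = "\<kappa> + 3 * (s + p * q * r / s)"
    let ?X = "diag3 x1 x2 x3"
    \<comment> \<open>The products are \<open>p, q, r\<close> and the two 3-cycles are \<open>s\<close> and \<open>p q r / s\<close>.\<close>
    let ?Y = "matrix3 (d + ?n) 1 (q / s) r (e + ?n) 1 s p (f + ?n)"
    have n: "1/3 * ((d + ?n) + (e + ?n) + (f + ?n)) = ?n"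
    proof -
      have "1/3 * ((d + ?n) + (e + ?n) + (f + ?n)) = 1/3 * (d + e + f) + ?n" by (simp add: field_simps)
      then show ?thesis by (simp add: d)
    qed
    have gv: "generator_value (1/3) ?X ?Y G = slice_values ?a ?b ?c d e f p q r s (p * q * r / s) G"
      if "G \<noteq> G_X" "G \<noteq> G_Y" for G
      unfolding generator_value_on_slice[OF that] n using s by (simp add: m_def mult_ac)
    \<comment> \<open>The coefficients \<open>b + c\<close>, \<open>a + c\<close>, \<open>a + b\<close> are \<open>- a\<close>, \<open>- b\<close>, \<open>- c\<close>.\<close>
    have xyy: "?a * d^2 + ?b * e^2 + ?c * f^2 + (?b + ?c) * p + (?a + ?c) * q + (?a + ?b) * r = z G_xyy"
      using p(2) abc by algebra
    have v: "(?b - ?c)^2 * p + (?a - ?c)^2 * q + (?a - ?b)^2 * r = z G_v"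
    proof -
      have "(?b - ?c)^2 * p + (?a - ?c)^2 * q + (?a - ?b)^2 * r
          = 2 * z G_xx * (p + q + r) - 3 * (?a^2 * p + ?b^2 * q + ?c^2 * r)"
        using abc unfolding z(2) by algebra
      then show ?thesis unfolding p(1,3) by (simp add: field_simps)
    qed
    have yy: "d^2 + e^2 + f^2 + 2 * (p + q + r) = z G_yy" unfolding p(1) by (simp add: field_simps)
    have "eval_at (\<lambda>G. poly (?q G) ?t) P = eval_at (generator_value (1/3) ?X ?Y) P"
    proof (rule w_free_eval_cong[OF P(1)])
      fix G :: gen assume "G \<noteq> G_w"
      show "poly (?q G) ?t = generator_value (1/3) ?X ?Y G"
      proof (cases G)
        case G_X
        then show ?thesis by (simp add: z trace_def sum_3 matrix3_def)
      next
        case G_Y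
        have "trace ?Y = (d + e + f) + z G_Y" by (simp add: trace_def sum_3 matrix3_def field_simps)
        then show ?thesis using G_Y by (simp add: d)
      qed (use \<open>G \<noteq> G_w\<close> in \<open>simp_all only: gv gen.distinct not_False_eq_True slice_values_def gen.case
            poly_pCons if_True if_False z d p yy xyy v \<kappa>_def, simp_all add: field_simps\<close>)
    qed
    also have "\<dots> = eval_at (entry_value ?X ?Y) (alg_hom generator P)"
      by (simp only: eval_at_alg_hom eval_at_generator)
    also have "\<dots> = 0" unfolding P(2) by (rule ring_hom_0[OF eval_mpoly_hom[OF id_hom]])
    finally show "eval_at (\<lambda>G. poly (?q G) ?t) P = 0" .
  qed
  then have "infinite {t. eval_at (\<lambda>G. poly (?q G) t) P = 0}"
    using infinite_hyperbola_values by (rule infinite_super)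
  from eval_at_zero_along_polynomial_curve[OF this, of "z G_yyy"] show ?thesis unfolding ev by simp
qed

text \<open>On the slice \<open>tr(X)\<close>, \<open>tr(x\<^sup>2)\<close> and \<open>tr(x\<^sup>3)\<close> are polynomials in the elementary symmetric functions
\<open>e\<^sub>1, e\<^sub>2, e\<^sub>3\<close> of the entries of \<open>X\<close>, and this change of coordinates is invertible.  The preceding vanishing, at
distinct entries and arbitrary values of the other generators, therefore extends to all points by the
independence of \<open>e\<^sub>1, e\<^sub>2, e\<^sub>3\<close>.\<close>
lemma w_free_independent:
  fixes P :: "(gen, 'k::field_char_0) mpoly"
  assumes P: "w_free P" "alg_hom generator P = 0"
  shows "P = 0"
proof (rule mpoly_eq_0_if_eval_0)
  fix z :: "gen \<Rightarrow> 'k"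
  note hom = eval_mpoly_hom[OF id_hom]
  let ?e1 = "Var 1 :: (3, 'k) mpoly" and ?e2 = "Var 2 :: (3, 'k) mpoly" and ?e3 = "Var 3 :: (3, 'k) mpoly"
  define g :: "gen \<Rightarrow> (3, 'k) mpoly" where "g = (\<lambda>G. Const (z G))
    (G_X := ?e1, G_xx := Const (2/3) * ?e1^2 - 2 * ?e2,
     G_xxx := Const (2/9) * ?e1^3 - ?e1 * ?e2 + 3 * ?e3)"
  have g: "(\<lambda>G. eval_at (triple s1 s2 s3) (g G)) = z(G_X := s1, G_xx := 2/3 * s1^2 - 2 * s2,
     G_xxx := 2/9 * s1^3 - s1 * s2 + 3 * s3)" for s1 s2 s3
    by (auto simp: g_def fun_eq_iff ring_hom_simps[OF hom] id_hom)
  have g_vals: "eval_at (triple s1 s2 s3) (g G_X) = s1"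
    "eval_at (triple s1 s2 s3) (g G_xx) = 2/3 * s1^2 - 2 * s2"
    "eval_at (triple s1 s2 s3) (g G_xxx) = 2/9 * s1^3 - s1 * s2 + 3 * s3" for s1 s2 s3
    using fun_cong[OF g[of s1 s2 s3], of G_X] fun_cong[OF g[of s1 s2 s3], of G_xx]
      fun_cong[OF g[of s1 s2 s3], of G_xxx] by simp_all
  have "cubic_disc * alg_hom g P = 0"
  proof (rule elementary_symmetric_independent)
    fix a b c :: 'k
    let ?s = "triple (a + b + c) (a*b + a*c + b*c) (a*b*c)"
    show "eval_at ?s (cubic_disc * alg_hom g P) = 0"
    proof (cases "eval_at ?s cubic_disc = 0")
      case True
      then show ?thesis by (simp add: ring_hom_simps[OF hom])
    next
      case False
      then have ne: "a \<noteq> b" "a \<noteq> c" "b \<noteq> c" unfolding eval_cubic_disc_at_roots by auto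
      have "eval_at (\<lambda>G. eval_at ?s (g G)) P = 0"
        by (rule vanishes_on_generator_values[OF P ne])
          (simp_all add: g_vals field_simps power2_eq_square power3_eq_cube)
      then show ?thesis by (simp add: ring_hom_simps[OF hom] eval_at_alg_hom)
    qed
  qed
  then have "alg_hom g P = 0" by (simp add: cubic_disc_nonzero)
  then have 0: "eval_at (\<lambda>G. eval_at (triple s1 s2 s3) (g G)) P = 0" for s1 s2 s3
    by (simp add: ring_hom_0[OF hom] flip: eval_at_alg_hom)
  define s2 where "s2 = (2/3 * z G_X^2 - z G_xx) / 2"
  define s3 where "s3 = (z G_xxx - 2/9 * z G_X^3 + z G_X * s2) / 3"
  have "(\<lambda>G. eval_at (triple (z G_X) s2 s3) (g G)) = z"
    unfolding g by (auto simp: fun_eq_iff s2_def s3_def field_simps)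
  with 0[of "z G_X" s2 s3] show "eval_at z P = 0" by simp
qed

text \<open>Applying transposition shows that the sum and the difference of the two summands vanish.\<close>
lemma generator_combination_zero:
  fixes a b :: "(gen, 'k::field_char_0) mpoly"
  assumes "w_free a" "w_free b" "alg_hom generator a + alg_hom generator b * generator G_w = 0"
  shows "a = 0" "b = 0"
proof -
  have t: "transpose_XY (alg_hom generator c) = alg_hom generator c" if "w_free c" for c :: "(gen, 'k) mpoly"
  proof -
    have "transpose_XY (alg_hom generator c) = alg_hom (\<lambda>G. transpose_XY (generator G)) c"
      unfolding transpose_XY_def by (rule alg_hom_alg_hom)
    also have "\<dots> = alg_hom generator c"
      by (rule w_free_alg_hom_cong[OF that]) (simp add: transpose_XY_generator)
    finally show ?thesis .
  qed
  have "transpose_XY (alg_hom generator a + alg_hom generator b * generator G_w)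
      = alg_hom generator a - alg_hom generator b * generator G_w"
    by (simp add: ring_hom_simps[OF transpose_XY_hom] t assms(1,2) transpose_XY_generator)
  then have minus: "alg_hom generator a - alg_hom generator b * generator G_w = 0"
    unfolding assms(3) by (simp add: ring_hom_0[OF transpose_XY_hom])
  have "2 * alg_hom generator a = 0" using assms(3) minus by algebra
  then have a: "alg_hom generator a = 0" using numeral_mpoly_neq_0 mult_eq_0_iff by blast
  then show "a = 0" by (rule w_free_independent[OF assms(1)])
  have "alg_hom generator b * generator G_w = 0" using assms(3) by (simp add: a)
  then have "alg_hom generator b = 0" by (simp add: generator_G_w_nonzero)
  then show "b = 0" by (rule w_free_independent[OF assms(2)])
qed

lemma generator_normal_form:
  "\<exists>a b. w_free a \<and> w_free b \<and> alg_hom generator P = alg_hom generator a + alg_hom generator b * generator G_w"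
proof -
  obtain Q a b where *: "w_free a" "w_free b" "P = relation * Q + a + b * Var G_w"
    using normal_form[of P] by blast
  have "alg_hom generator P = alg_hom generator a + alg_hom generator b * generator G_w"
    unfolding *(3) by (simp add: ring_hom_simps[OF alg_hom_hom] relation_holds)
  with * show ?thesis by blast
qed

lemma kernel_principal: "{P :: (gen, 'k::field_char_0) mpoly. alg_hom generator P = 0} = principal_ideal relation"
proof (intro set_eqI iffI)
  fix P :: "(gen, 'k) mpoly"
  assume "P \<in> {P. alg_hom generator P = 0}"
  then have P: "alg_hom generator P = 0" by simp
  obtain Q a b where *: "w_free a" "w_free b" "P = relation * Q + a + b * Var G_w"
    using normal_form[of P] by blast
  have "alg_hom generator a + alg_hom generator b * generator G_w = 0"
    using P unfolding *(3) by (simp add: ring_hom_simps[OF alg_hom_hom] relation_holds)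
  then have "a = 0" "b = 0" using generator_combination_zero[OF *(1,2)] by blast+
  then have "P = Q * relation" using *(3) by (simp add: mult.commute)
  then show "P \<in> principal_ideal relation" by (auto simp: principal_ideal_def)
next
  fix P :: "(gen, 'k) mpoly"
  assume "P \<in> principal_ideal relation"
  then show "P \<in> {P. alg_hom generator P = 0}"
    by (auto simp: principal_ideal_def ring_hom_simps[OF alg_hom_hom] relation_holds)
qed

text \<open>In the variable \<open>G_xxx\<close> the polynomial \<open>x_disc\<close> is monic and \<open>y_disc\<close> is constant.  Dividing \<open>a\<close> by the power of
\<open>x_disc\<close> leaves a remainder \<open>r\<close> of smaller degree; \<open>y_disc\<^sup>m r\<close> has the same degree and is a multiple of that
power, so \<open>r = 0\<close>.\<close>
lemma x_disc_y_disc_coprime: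
  fixes a b :: "(gen, 'k::field_char_0) mpoly"
  assumes "y_disc Var ^ m * a = x_disc Var ^ n * b"
  shows "\<exists>c. a = x_disc Var ^ n * c"
proof -
  have const: "is_ring_hom (\<lambda>c::'k. [:Const c :: (gen, 'k) mpoly:])"
    by (rule is_ring_hom_comp[OF Const_hom const_poly_hom])
  \<comment> \<open>\<open>\<Phi>\<close> singles out the variable \<open>G_xxx\<close> as that of a univariate polynomial.\<close>
  define \<Phi> :: "(gen, 'k) mpoly \<Rightarrow> (gen, 'k) mpoly poly" where
    "\<Phi> = eval_mpoly (\<lambda>c. [:Const c:]) (\<lambda>G. if G = G_xxx then [:0, 1:] else [:Var G:])"
  have hom: "is_ring_hom \<Phi>" unfolding \<Phi>_def by (rule eval_mpoly_hom[OF const])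
  have \<Phi>_Var: "\<Phi> (Var G) = (if G = G_xxx then [:0, 1:] else [:Var G:])" for G
    by (simp add: \<Phi>_def const)
  have \<Phi>_Const: "\<Phi> (Const c) = [:Const c:]" for c by (simp add: \<Phi>_def const)
  have substitute_back: "poly (\<Phi> p) (Var G_xxx) = p" for p
  proof (rule mpoly_hom_eqI[OF is_ring_hom_comp[OF hom poly_eval_hom] id_hom])
    show "poly (\<Phi> (Const c)) (Var G_xxx) = Const c" for c by (simp add: \<Phi>_Const)
    show "poly (\<Phi> (Var G)) (Var G_xxx) = Var G" for G by (simp add: \<Phi>_Var)
  qed
  have pc: "[:u:] ^ k = [:u ^ k:]" for u :: "(gen, 'k) mpoly" and k
    by (induction k) (simp_all add: one_pCons)
  define q where "q = (y_disc Var :: (gen, 'k) mpoly) ^ m"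
  have \<Phi>q: "\<Phi> q = [:q:]"
    by (simp add: q_def y_disc_def ring_hom_simps[OF hom] \<Phi>_Var \<Phi>_Const pc mult.commute)
  define g where "g = [:- (Const (1/6) * Var G_xx ^ 3), 0, 1 :: (gen, 'k) mpoly:]"
  have \<Phi>x: "\<Phi> (x_disc Var) = g"
    by (simp add: x_disc_def ring_hom_simps[OF hom] \<Phi>_Var \<Phi>_Const pc g_def power2_eq_square)
  have lead: "coeff (g ^ n) (degree (g ^ n)) = 1"
    by (simp add: lead_coeff_power g_def)
  have g0: "g ^ n \<noteq> 0" by (simp add: g_def)
  have q0: "q \<noteq> 0"
  proof
    assume "q = 0"
    then have "y_disc Var = (0 :: (gen, 'k) mpoly)" by (simp add: q_def)
    then have "eval_at (\<lambda>G. if G = G_yyy then 1 else 0) (y_disc Var :: (gen, 'k) mpoly) = 0"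
      by (simp add: ring_hom_0[OF eval_mpoly_hom[OF id_hom]])
    then show False by (simp add: y_disc_def ring_hom_simps[OF eval_mpoly_hom[OF id_hom]] id_hom)
  qed
  obtain s r where sr: "pseudo_divmod (\<Phi> a) (g ^ n) = (s, r)" by fastforce
  from pseudo_divmod[OF g0 sr]
  have s: "\<Phi> a = g ^ n * s + r" and r: "r = 0 \<or> degree r < degree (g ^ n)"
    by (simp_all add: lead)
  have "[:q:] * \<Phi> a = g ^ n * \<Phi> b"
    using arg_cong[OF assms, of \<Phi>] by (simp add: ring_hom_simps[OF hom] \<Phi>x \<Phi>q flip: q_def)
  then have eq: "g ^ n * (\<Phi> b - [:q:] * s) = [:q:] * r"
    unfolding s by (simp add: algebra_simps)
  have "r = 0"
  proof (rule ccontr)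
    assume r0: "r \<noteq> 0"
    with q0 have "[:q:] * r \<noteq> 0" by simp
    with eq have "\<Phi> b - [:q:] * s \<noteq> 0" by auto
    then have "degree (g ^ n) \<le> degree (g ^ n * (\<Phi> b - [:q:] * s))"
      using g0 by (simp add: degree_mult_eq)
    also have "\<dots> = degree r" unfolding eq using q0 by simp
    finally show False using r r0 by simp
  qed
  then have "\<Phi> a = \<Phi> (x_disc Var ^ n) * s" using s by (simp add: ring_hom_simps[OF hom] \<Phi>x)
  then have "a = x_disc Var ^ n * poly s (Var G_xxx)"
    using substitute_back[of a] substitute_back[of "x_disc Var ^ n"] by (metis poly_mult)
  then show ?thesis by blast
qed

text \<open>Write \<open>x_disc\<^sup>n f\<close> and \<open>y_disc\<^sup>m f\<close> in normal form.  Comparing coefficients, which is possible by independence,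
coprimality shows that \<open>x_disc\<^sup>n\<close> divides both coefficients of the first normal form, and it can be cancelled.\<close>
lemma C32_subset_trace_algebra:
  fixes f :: "'k::field_char_0 Omega"
  assumes f: "f \<in> C32"
  shows "f \<in> trace_algebra"
proof -
  obtain n P where n: "x_disc generator ^ n * f = alg_hom generator P"
    using x_disc_power_in_trace_algebra[OF f] by blast
  obtain m Q where m: "y_disc generator ^ m * f = alg_hom generator Q"
    using y_disc_power_in_trace_algebra[OF f] by blast
  obtain a b where ab: "w_free a" "w_free b"
    "alg_hom generator P = alg_hom generator a + alg_hom generator b * generator G_w"
    using generator_normal_form by blast
  obtain a' b' where ab': "w_free a'" "w_free b'"
    "alg_hom generator Q = alg_hom generator a' + alg_hom generator b' * generator G_w"
    using generator_normal_form by blast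
  let ?p = "x_disc Var :: (gen, 'k) mpoly" and ?q = "y_disc Var :: (gen, 'k) mpoly"
  have p: "alg_hom generator ?p = x_disc generator" and q: "alg_hom generator ?q = y_disc generator"
    by (simp_all add: x_disc_def y_disc_def ring_hom_simps[OF alg_hom_hom])
  have free: "w_free ?p" "w_free ?q"
    by (simp_all add: x_disc_def y_disc_def w_free_simps)
  have "alg_hom generator (?q ^ m * a - ?p ^ n * a') + alg_hom generator (?q ^ m * b - ?p ^ n * b') * generator G_w
      = y_disc generator ^ m * alg_hom generator P - x_disc generator ^ n * alg_hom generator Q"
    unfolding ab(3) ab'(3) ring_hom_simps[OF alg_hom_hom] p q by (simp add: algebra_simps)
  also have "\<dots> = 0" unfolding n[symmetric] m[symmetric] by (simp add: mult_ac)
  finally have zero: "alg_hom generator (?q ^ m * a - ?p ^ n * a')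
      + alg_hom generator (?q ^ m * b - ?p ^ n * b') * generator G_w = 0" .
  have "?q ^ m * a - ?p ^ n * a' = 0" "?q ^ m * b - ?p ^ n * b' = 0"
    by (rule generator_combination_zero[OF _ _ zero]; simp add: w_free_simps free ab ab')+
  then obtain c d where c: "a = ?p ^ n * c" "b = ?p ^ n * d"
    using x_disc_y_disc_coprime by (metis right_minus_eq)
  have "x_disc generator ^ n * f = x_disc generator ^ n * alg_hom generator (c + d * Var G_w)"
    unfolding n ab(3) c by (simp add: ring_hom_simps[OF alg_hom_hom] p algebra_simps)
  moreover have "x_disc generator \<noteq> (0 :: 'k Omega)"
  proof
    assume "x_disc generator = (0 :: 'k Omega)"
    then have "?p = 0" using w_free_independent[OF free(1)] p by simp
    then have "eval_at (\<lambda>G. if G = G_xxx then 1 else 0) ?p = 0"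
      by (simp add: ring_hom_0[OF eval_mpoly_hom[OF id_hom]])
    then show False by (simp add: x_disc_def ring_hom_simps[OF eval_mpoly_hom[OF id_hom]] id_hom)
  qed
  ultimately have "f = alg_hom generator (c + d * Var G_w)" by simp
  then show ?thesis by simp
qed

theorem theorem1p2:
  shows "generated_subalgebra (range generator) = (C32 :: 'k::field_char_0 Omega set) \<and>
         range (alg_hom generator) = (C32 :: 'k Omega set) \<and>
         {P :: (gen, 'k) mpoly. alg_hom generator P = 0} = principal_ideal relation"
proof -
  have "range (alg_hom generator) = (C32 :: 'k Omega set)"
    using trace_algebra_subset_C32 C32_subset_trace_algebra by blast
  then show ?thesis by (simp add: generated_subalgebra_range kernel_principal)
qed

end
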